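(* Let $T\subset\mathbb C^2$ be a totally real torus which is provided with an analytic filling $F\colon S^1\times\mathbb D\to\mathbb C^2$. Then there exists an isotopy $\Phi=(\Phi_s)_{s\in[0,1]}$ of embeddings $\Phi_s\colon S^1\times\partial\mathbb D\to\mathbb C^2$ that connects $\Phi_0=F|_{S^1\times\partial\mathbb D}$ with the parametrization $\Phi_1(t,\mathrm e^{\mathrm i\theta})=(\mathrm e^{\mathrm it},\mathrm e^{\mathrm i\theta})$ of the Clifford torus $\partial\mathbb D\times\partial\mathbb D\subset\mathbb C\times\mathbb C$, such that the image tori $\Phi_s(S^1\times\partial\mathbb D)$ are totally real for all $s\in[0,1]$.
   Context: Notation: $S^1=\mathbb R/2\pi\mathbb Z$ and $\mathbb D=\{|z|\le 1\}\subset\mathbb C$. An embedded $2$-dimensional torus $T\subset\mathbb C^2$ is totally real if no complex line is tangent to $T$. An analytic filling of a totally real torus $T$ is an embedding $F$ of the solid torus $S^1\times\mathbb D$ into $\mathbb C^2$ such that the boundary $S^1\times\partial\mathbb D$ is mapped onto $T$ and, for all $t\in S^1$, the restriction of $u_t:=F(t,\cdot)$ to the interior of $\mathbb D$ is a holomorphic map, i.e. $\partial_xu_t+\mathrm i\,\partial_yu_t=0$ on $\mathrm{Int}\,\mathbb D$, where $z=x+\mathrm iy$.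
   Formalization: The isotopy starts not at F restricted to the boundary but at (t,z) ↦ F(t,e^{ikt}z) for some integer k; as stated the claim fails, e.g. for F(t,z)=(e^{it},e^{it}z), whose determinant has winding number 2 in t instead of 1. *)

theory Defs
  imports "HOL-Complex_Analysis.Complex_Analysis"
begin

text \<open>
  Conventions. The space \<open>\<complex>\<^sup>2\<close> is \<open>complex \<times> complex\<close>, and \<open>S\<^sup>1 = \<real>/2\<pi>\<int>\<close>: a map on \<open>S\<^sup>1 \<times> X\<close> with
  \<open>X \<subseteq> \<complex>\<close> is a map on \<open>real \<times> complex\<close> that is \<open>2\<pi>\<close>-periodic in the first variable; its values
  outside \<open>UNIV \<times> X\<close> are irrelevant. Smooth means \<open>C\<^sup>\<infinity>\<close>.
\<close>

primrec Ck_on ::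
  "nat \<Rightarrow> 'a::real_normed_vector set \<Rightarrow> ('a \<Rightarrow> 'b::real_normed_vector) \<Rightarrow> bool" where
  "Ck_on 0 U f \<longleftrightarrow> continuous_on U f"
| "Ck_on (Suc k) U f \<longleftrightarrow>
     (\<forall>x\<in>U. f differentiable (at x)) \<and> (\<forall>v. Ck_on k U (\<lambda>x. frechet_derivative f (at x) v))"

text \<open>
  \<open>Ck_on\<close> is meant for open sets. On an arbitrary set, smooth means locally extendable to a smooth
  map on an open set; on \<open>UNIV \<times> cball 0 1\<close> this is smoothness up to the boundary.
\<close>

definition smooth_on ::
  "'a::real_normed_vector set \<Rightarrow> ('a \<Rightarrow> 'b::real_normed_vector) \<Rightarrow> bool" where
  "smooth_on S f \<longleftrightarrow>
     (\<forall>p\<in>S. \<exists>U g. open U \<and> p \<in> U \<and> (\<forall>k. Ck_on k U g) \<and> (\<forall>x\<in>U \<inter> S. g x = f x))"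

text \<open>
  Only used for \<open>UNIV\<close> and \<open>UNIV \<times> cball 0 1\<close>, where the derivative within the set is unique, also
  at boundary points.
\<close>

definition immersion_on ::
  "'a::real_normed_vector set \<Rightarrow> ('a \<Rightarrow> 'b::real_normed_vector) \<Rightarrow> bool" where
  "immersion_on S f \<longleftrightarrow> (\<forall>p\<in>S. \<exists>D. (f has_derivative D) (at p within S) \<and> inj D)"

definition circle_periodic_on :: "complex set \<Rightarrow> (real \<times> complex \<Rightarrow> 'b) \<Rightarrow> bool" where
  "circle_periodic_on X f \<longleftrightarrow> (\<forall>t. \<forall>z\<in>X. f (t + 2 * pi, z) = f (t, z))"

text \<open>
  As \<open>S\<^sup>1 \<times> \<D>\<close> and \<open>S\<^sup>1 \<times> \<partial>\<D>\<close> are compact, an injective immersion of either is an embedding. The set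
  \<open>{0..<2 * pi}\<close> contains one representative of each point of \<open>S\<^sup>1\<close>.
\<close>

definition solid_torus_embedding :: "(real \<times> complex \<Rightarrow> complex \<times> complex) \<Rightarrow> bool" where
  "solid_torus_embedding F \<longleftrightarrow>
     circle_periodic_on (cball 0 1) F \<and>
     smooth_on (UNIV \<times> cball 0 1) F \<and>
     immersion_on (UNIV \<times> cball 0 1) F \<and>
     inj_on F ({0..<2 * pi} \<times> cball 0 1)"

text \<open>
  Smoothness and immersivity of a map on \<open>S\<^sup>1 \<times> \<partial>\<D>\<close> are expressed in the coordinates \<open>(t, \<theta>)\<close>, via
  the local diffeomorphism \<open>(t, \<theta>) \<mapsto> (t, e\<^sup>i\<^sup>\<theta>)\<close>.
\<close>

definition torus_embedding :: "(real \<times> complex \<Rightarrow> complex \<times> complex) \<Rightarrow> bool" where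
  "torus_embedding f \<longleftrightarrow>
     circle_periodic_on (sphere 0 1) f \<and>
     smooth_on UNIV (\<lambda>(t, \<theta>). f (t, cis \<theta>)) \<and>
     immersion_on UNIV (\<lambda>(t, \<theta>). f (t, cis \<theta>)) \<and>
     inj_on f ({0..<2 * pi} \<times> sphere 0 1)"

definition torus_isotopy :: "(real \<Rightarrow> real \<times> complex \<Rightarrow> complex \<times> complex) \<Rightarrow> bool" where
  "torus_isotopy \<Phi> \<longleftrightarrow>
     smooth_on ({0..1} \<times> UNIV \<times> UNIV) (\<lambda>(s, t, \<theta>). \<Phi> s (t, cis \<theta>)) \<and>
     (\<forall>s\<in>{0..1}. torus_embedding (\<Phi> s))"

definition boundary_image :: "(real \<times> complex \<Rightarrow> 'b) \<Rightarrow> 'b set" where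
  "boundary_image f = f ` (UNIV \<times> sphere 0 1)"

text \<open>For an embedded submanifold \<open>T\<close> this is the tangent space of \<open>T\<close> at \<open>p\<close>.\<close>

definition tangent_vectors :: "'a::real_normed_vector set \<Rightarrow> 'a \<Rightarrow> 'a set" where
  "tangent_vectors T p =
     {v. \<exists>c::real \<Rightarrow> 'a. range c \<subseteq> T \<and> c 0 = p \<and> (c has_vector_derivative v) (at 0)}"

definition complex_line :: "complex \<times> complex \<Rightarrow> (complex \<times> complex) set" where
  "complex_line v = range (\<lambda>a. (a * fst v, a * snd v))"

definition totally_real_torus :: "(complex \<times> complex) set \<Rightarrow> bool" where
  "totally_real_torus T \<longleftrightarrow>
     (\<exists>f. torus_embedding f \<and> boundary_image f = T) \<and>
     (\<forall>p\<in>T. \<not> (\<exists>v. v \<noteq> 0 \<and> complex_line v \<subseteq> tangent_vectors T p))"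

definition analytic_filling ::
  "(complex \<times> complex) set \<Rightarrow> (real \<times> complex \<Rightarrow> complex \<times> complex) \<Rightarrow> bool" where
  "analytic_filling T F \<longleftrightarrow>
     solid_torus_embedding F \<and>
     boundary_image F = T \<and>
     (\<forall>t. (\<lambda>z. fst (F (t, z))) holomorphic_on ball 0 1 \<and>
          (\<lambda>z. snd (F (t, z))) holomorphic_on ball 0 1)"

text \<open>
  The filling \<open>F\<close> with the disc over \<open>t\<close> reparametrized by the rotation through the angle \<open>k t\<close>; it has
  the same image, the same discs and the same boundary torus.

  The isotopy in the theorem cannot in general start at \<open>F\<close> restricted to \<open>S\<^sup>1 \<times> \<partial>\<D>\<close> itself, and some
  such rotation is needed: for \<open>f = \<Phi>\<^sub>s\<close> the function \<open>det (\<partial>\<^sub>t f, \<partial>\<^sub>\<theta> f)\<close> has no zeros, as the image is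
  totally real, so its winding number along \<open>t \<mapsto> (t, 1)\<close> does not depend on \<open>s\<close>. It is \<open>1\<close> for
  \<open>(e\<^sup>i\<^sup>t, e\<^sup>i\<^sup>\<theta>)\<close>, but \<open>2\<close> for the filling \<open>F (t, z) = (e\<^sup>i\<^sup>t, e\<^sup>i\<^sup>t z)\<close> of the Clifford torus. Replacing \<open>F\<close>
  by \<open>disc_twist k F\<close> adds \<open>k\<close> to it, so exactly one \<open>k\<close> can occur.
\<close>

definition disc_twist :: "int \<Rightarrow> (real \<times> complex \<Rightarrow> 'b) \<Rightarrow> real \<times> complex \<Rightarrow> 'b" where
  "disc_twist k F = (\<lambda>(t, z). F (t, cis (of_int k * t) * z))"

end

theory Submission
  imports Defs
begin

text \<open>
  The isotopy shrinks the circles \<open>F (t, \<partial>\<D>)\<close> inside their holomorphic discs until the torus lies in a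
  thin tube around the core curve \<open>\<gamma> t = F (t, 0)\<close>, deforms the thin tube to a standard one, and
  expands the circles again.

  All tori in the process have the form \<open>G (\<sigma>, t, r e\<^sup>i\<^sup>\<theta>)\<close>, where \<open>G (\<sigma>, t, \<cdot>)\<close> is holomorphic, and
  their tangent planes are spanned over the reals by \<open>\<partial>\<^sub>t G\<close>, possibly plus a complex multiple of
  \<open>\<partial>\<^sub>z G\<close>, and a nonzero complex multiple of \<open>\<partial>\<^sub>z G\<close>. If the complex determinant of
  \<open>(\<partial>\<^sub>t G, \<partial>\<^sub>z G)\<close> has no zero, then this plane contains no complex line and the parametrization is an immersion
  (\<open>rotated_tube_torus\<close>). For \<open>G = F\<close> the determinant has no zero in the open disc, as the derivative
  of \<open>F\<close> is injective and complex linear in \<open>z\<close> (\<open>filling_interior_derivative\<close>). So shrinking the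
  radius inside the filling keeps the torus totally real.

  The core is straightened because there is enough room in four real dimensions: the straight-line
  homotopy from \<open>\<gamma>\<close> to \<open>e\<^sup>i\<^sup>t w\<close> with \<open>w \<noteq> 0\<close> fails to be an isotopy only if \<open>w\<close> lies in the union of the images of
  two smooth maps, with three and with two real parameters, and such images have measure zero
  (\<open>generic_circle\<close>). The directions of the discs along the core follow: a vector field \<open>v\<close> that
  is complex independent of \<open>\<gamma>'\<close> is \<open>\<alpha> \<gamma>' + \<beta> j \<gamma>'\<close> with a nowhere vanishing function \<open>\<beta>\<close>, where
  \<open>j\<close> is a quaternionic unit, so \<open>\<alpha>\<close> can be contracted to zero, and \<open>\<beta>\<close> can be contracted
  to \<open>e\<^sup>i\<^sup>m\<^sup>t\<close> times a standard function, where \<open>m\<close> is a winding number (\<open>framing_homotopy\<close>). The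
  number \<open>m\<close> is compensated by the rotation \<open>k = - m\<close> of the discs.

  Both deformations are written into one explicit family \<open>G\<close> with \<open>G (0, \<cdot>) = F\<close> and \<open>G (1, \<cdot>)\<close> complex
  linear in \<open>(e\<^sup>i\<^sup>t, e\<^sup>i\<^sup>m\<^sup>t z)\<close> (\<open>straightening_family\<close>). A compactness argument gives one radius \<open>\<epsilon>\<close>
  up to which every member of the family is an embedding with nonvanishing determinant
  (\<open>uniform_tube\<close>). The isotopy then follows a path in the \<open>(\<sigma>, r)\<close>-plane from \<open>(0, 1)\<close> through
  \<open>(0, \<epsilon>)\<close> and \<open>(1, \<epsilon>)\<close> to \<open>(1, 1)\<close>; a flat function makes the path smooth at its corners. Composing
  with a path of complex linear isomorphisms, which preserve everything in question, turns the last
  torus into the Clifford torus with its standard parametrization.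
\<close>

section \<open>Smooth maps\<close>

lemma Ck_on_cong:
  assumes "open U" and "\<And>x. x \<in> U \<Longrightarrow> f x = g x" and "Ck_on k U f"
  shows "Ck_on k U g"
  using assms(2,3)
proof (induction k arbitrary: f g)
  case 0
  then show ?case by (auto cong: continuous_on_cong)
next
  case (Suc k)
  have diff: "f differentiable at x" if "x \<in> U" for x
    using Suc.prems(2) that by simp
  have "g differentiable at x" if "x \<in> U" for x
    using diff[OF that] has_derivative_transform_within_open[of f _ x UNIV U g] \<open>open U\<close> that Suc.prems(1)
    unfolding differentiable_def by blast
  moreover have "frechet_derivative f (at x) = frechet_derivative g (at x)" if "x \<in> U" for x
    by (rule frechet_derivative_transform_within_open[OF diff[OF that] \<open>open U\<close> that Suc.prems(1)])
  then have "Ck_on k U (\<lambda>x. frechet_derivative g (at x) v)" for v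
    using Suc.IH[of "\<lambda>x. frechet_derivative f (at x) v" "\<lambda>x. frechet_derivative g (at x) v"]
      Suc.prems(2) by auto
  ultimately show ?case by simp
qed

lemma Ck_on_SucI:
  assumes "open U" and "\<And>x. x \<in> U \<Longrightarrow> (f has_derivative f' x) (at x)"
    and "\<And>v. Ck_on k U (\<lambda>x. f' x v)"
  shows "Ck_on (Suc k) U f"
proof -
  have "f' x = frechet_derivative f (at x)" if "x \<in> U" for x
    by (rule frechet_derivative_at[OF assms(2)[OF that]])
  then have "Ck_on k U (\<lambda>x. frechet_derivative f (at x) v)" for v
    by (intro Ck_on_cong[OF \<open>open U\<close> _ assms(3)[of v]]) auto
  then show ?thesis
    using assms(2) by (auto simp: differentiable_def)
qed

lemma Ck_on_Suc_has_derivative: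
  assumes "Ck_on (Suc k) U f" and "x \<in> U"
  shows "(f has_derivative frechet_derivative f (at x)) (at x)"
  using assms frechet_derivative_works by auto

lemma Ck_on_Suc_imp_Ck_on:
  "Ck_on (Suc k) U f \<Longrightarrow> Ck_on k U f"
proof (induction k arbitrary: f)
  case 0
  then show ?case
    by (auto intro!: continuous_at_imp_continuous_on differentiable_imp_continuous_within)
qed auto

lemma Ck_on_imp_continuous_on: "Ck_on k U f \<Longrightarrow> continuous_on U f"
  by (induction k) (auto dest: Ck_on_Suc_imp_Ck_on simp del: Ck_on.simps(2))

lemma Ck_on_subset:
  "Ck_on k U f \<Longrightarrow> V \<subseteq> U \<Longrightarrow> Ck_on k V f"
  by (induction k arbitrary: f) (auto intro: continuous_on_subset)

lemma Ck_on_const: "open U \<Longrightarrow> Ck_on k U (\<lambda>x. c)"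
  by (induction k arbitrary: c) (auto intro!: Ck_on_SucI[where f' = "\<lambda>x v. 0"] simp del: Ck_on.simps(2))

lemma Ck_on_linear:
  assumes "bounded_linear f" and "open U"
  shows "Ck_on k U f"
proof (cases k)
  case 0
  then show ?thesis using assms by (simp add: linear_continuous_on)
next
  case (Suc n)
  show ?thesis unfolding Suc
    using assms by (intro Ck_on_SucI[where f' = "\<lambda>x. f"])
      (auto intro: bounded_linear_imp_has_derivative Ck_on_const)
qed

lemma Ck_on_add:
  assumes "open U"
  shows "Ck_on k U f \<Longrightarrow> Ck_on k U g \<Longrightarrow> Ck_on k U (\<lambda>x. f x + g x)"
proof (induction k arbitrary: f g)
  case 0
  then show ?case by (auto intro: continuous_on_add)
next
  case (Suc k)
  show ?case
    using Suc.prems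
    by (intro Ck_on_SucI[OF \<open>open U\<close>, where
          f' = "\<lambda>x v. frechet_derivative f (at x) v + frechet_derivative g (at x) v"]
        has_derivative_add Ck_on_Suc_has_derivative Suc.IH) auto
qed

lemma Ck_on_sum:
  assumes "open U" and "\<And>i. i \<in> I \<Longrightarrow> Ck_on k U (f i)"
  shows "Ck_on k U (\<lambda>x. \<Sum>i\<in>I. f i x)"
  using assms(2)
  by (induction I rule: infinite_finite_induct) (auto intro: Ck_on_const Ck_on_add \<open>open U\<close>)

lemma Ck_on_bilinear:
  assumes "open U" and "bounded_bilinear b"
  shows "Ck_on k U f \<Longrightarrow> Ck_on k U g \<Longrightarrow> Ck_on k U (\<lambda>x. b (f x) (g x))"
proof (induction k arbitrary: f g)
  case 0
  then show ?case using bounded_bilinear.continuous_on[OF assms(2)] by auto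
next
  case (Suc k)
  let ?f' = "\<lambda>x. frechet_derivative f (at x)" and ?g' = "\<lambda>x. frechet_derivative g (at x)"
  show ?case
  proof (rule Ck_on_SucI[OF \<open>open U\<close>, where f' = "\<lambda>x v. b (f x) (?g' x v) + b (?f' x v) (g x)"])
    show "((\<lambda>x. b (f x) (g x)) has_derivative (\<lambda>v. b (f x) (?g' x v) + b (?f' x v) (g x))) (at x)"
      if "x \<in> U" for x
      by (rule bounded_bilinear.FDERIV[OF assms(2)])
        (use Suc.prems that in \<open>auto intro: Ck_on_Suc_has_derivative simp del: Ck_on.simps(2)\<close>)
    show "Ck_on k U (\<lambda>x. b (f x) (?g' x v) + b (?f' x v) (g x))" for v
      using Suc.prems Suc.prems[THEN Ck_on_Suc_imp_Ck_on]
      by (intro Ck_on_add[OF \<open>open U\<close>] Suc.IH) auto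
  qed
qed

text \<open>
  The condition \<open>Ck_on (Suc k)\<close> speaks of derivatives in fixed directions, whereas the chain rule
  produces the derivative of \<open>g\<close> in the varying direction \<open>D f x v\<close>. Expanding this direction in a
  basis of the finite-dimensional space in the middle leads back to fixed directions.
\<close>

lemma Ck_on_compose:
  fixes f :: "'a::real_normed_vector \<Rightarrow> 'b::euclidean_space"
    and g :: "'b \<Rightarrow> 'c::real_normed_vector"
  assumes "open U" and "f ` U \<subseteq> V"
  shows "Ck_on k U f \<Longrightarrow> Ck_on k V g \<Longrightarrow> Ck_on k U (\<lambda>x. g (f x))"
proof (induction k arbitrary: g)
  case 0
  then show ?case using assms(2) by (auto intro: continuous_on_compose2)
next
  case (Suc k)
  let ?f' = "\<lambda>x. frechet_derivative f (at x)" and ?g' = "\<lambda>y. frechet_derivative g (at y)"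
  show ?case
  proof (rule Ck_on_SucI[OF \<open>open U\<close>,
        where f' = "\<lambda>x v. \<Sum>e\<in>Basis. (?f' x v \<bullet> e) *\<^sub>R ?g' (f x) e"])
    fix x assume "x \<in> U"
    then have g: "(g has_derivative ?g' (f x)) (at (f x))"
      using Suc.prems(2) assms(2) by (intro Ck_on_Suc_has_derivative) auto
    have f: "(f has_derivative ?f' x) (at x)"
      using Suc.prems(1) \<open>x \<in> U\<close> by (rule Ck_on_Suc_has_derivative)
    interpret g': bounded_linear "?g' (f x)"
      using g by (rule has_derivative_bounded_linear)
    have "(\<Sum>e\<in>Basis. (w \<bullet> e) *\<^sub>R ?g' (f x) e) = ?g' (f x) w" for w
      by (subst (2) euclidean_representation[of w, symmetric]) (simp only: g'.sum g'.scaleR)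
    then show "((\<lambda>x. g (f x)) has_derivative (\<lambda>v. \<Sum>e\<in>Basis. (?f' x v \<bullet> e) *\<^sub>R ?g' (f x) e)) (at x)"
      using has_derivative_compose[OF f g] by simp
  next
    fix v
    show "Ck_on k U (\<lambda>x. \<Sum>e\<in>Basis. (?f' x v \<bullet> e) *\<^sub>R ?g' (f x) e)"
    proof (intro Ck_on_sum[OF \<open>open U\<close>] Ck_on_bilinear[OF \<open>open U\<close> bounded_bilinear_scaleR]
        Ck_on_bilinear[OF \<open>open U\<close> bounded_bilinear_inner] Ck_on_const[OF \<open>open U\<close>] )
      show "Ck_on k U (\<lambda>x. ?f' x v)"
        using Suc.prems(1) by simp
      show "Ck_on k U (\<lambda>x. ?g' (f x) e)" for e
        using Suc.prems(2) by (intro Suc.IH Ck_on_Suc_imp_Ck_on[OF Suc.prems(1)]) simp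
    qed
  qed
qed

lemma Ck_on_local:
  "(\<And>p. p \<in> S \<Longrightarrow> \<exists>U. open U \<and> p \<in> U \<and> Ck_on k U f) \<Longrightarrow> Ck_on k S f"
proof (induction k arbitrary: f)
  case 0
  show ?case
  proof (simp, rule continuous_at_imp_continuous_on, rule)
    fix p assume "p \<in> S"
    then show "isCont f p"
      using 0 continuous_on_eq_continuous_at by fastforce
  qed
next
  case (Suc k)
  have "f differentiable at p" if "p \<in> S" for p
    using Suc.prems[OF that] by auto
  moreover have "Ck_on k S (\<lambda>x. frechet_derivative f (at x) v)" for v
  proof (rule Suc.IH)
    fix p assume "p \<in> S"
    then show "\<exists>U. open U \<and> p \<in> U \<and> Ck_on k U (\<lambda>x. frechet_derivative f (at x) v)"
      using Suc.prems[of p] by auto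
  qed
  ultimately show ?case by simp
qed

lemma smooth_on_open_iff:
  assumes "open S"
  shows "smooth_on S f \<longleftrightarrow> (\<forall>k. Ck_on k S f)"
proof
  assume f: "smooth_on S f"
  show "\<forall>k. Ck_on k S f"
  proof (intro allI Ck_on_local)
    fix k p assume "p \<in> S"
    then obtain U g where U: "open U" "p \<in> U" "\<And>k. Ck_on k U g" "\<And>x. x \<in> U \<inter> S \<Longrightarrow> g x = f x"
      using f unfolding smooth_on_def by meson
    then have "Ck_on k (U \<inter> S) f"
      using Ck_on_cong[of "U \<inter> S" g f k] Ck_on_subset[of k U g "U \<inter> S"] \<open>open S\<close> by auto
    then show "\<exists>U. open U \<and> p \<in> U \<and> Ck_on k U f"
      using U \<open>p \<in> S\<close> \<open>open S\<close> by (intro exI[of _ "U \<inter> S"]) auto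
  qed
next
  assume "\<forall>k. Ck_on k S f"
  then show "smooth_on S f"
    unfolding smooth_on_def using \<open>open S\<close> by blast
qed

lemma smooth_on_subset: "smooth_on S f \<Longrightarrow> S' \<subseteq> S \<Longrightarrow> smooth_on S' f"
  unfolding smooth_on_def
proof
  fix p assume *: "S' \<subseteq> S" "p \<in> S'"
    and "\<forall>p\<in>S. \<exists>U g. open U \<and> p \<in> U \<and> (\<forall>k. Ck_on k U g) \<and> (\<forall>x\<in>U \<inter> S. g x = f x)"
  then obtain U g where "open U" "p \<in> U" "\<forall>k. Ck_on k U g" "\<forall>x\<in>U \<inter> S. g x = f x"
    by (meson subsetD)
  then show "\<exists>U g. open U \<and> p \<in> U \<and> (\<forall>k. Ck_on k U g) \<and> (\<forall>x\<in>U \<inter> S'. g x = f x)"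
    using * by (intro exI[of _ U] exI[of _ g]) auto
qed

lemma smooth_on_imp_continuous_on:
  assumes "smooth_on S f"
  shows "continuous_on S f"
  unfolding continuous_on_eq_continuous_within
proof
  fix p assume p: "p \<in> S"
  then obtain U g where U: "open U" "p \<in> U" "\<And>k. Ck_on k U g" "\<And>x. x \<in> U \<inter> S \<Longrightarrow> g x = f x"
    using assms unfolding smooth_on_def by meson
  then have "isCont g p"
    using Ck_on_imp_continuous_on continuous_on_eq_continuous_at by blast
  then have "continuous (at p within S) g"
    by (rule continuous_at_imp_continuous_at_within)
  moreover have "\<forall>\<^sub>F x in at p within S. f x = g x"
    unfolding eventually_at_topological using U by (metis IntI)
  ultimately show "continuous (at p within S) f"
    using U p by (simp add: continuous_within tendsto_cong)
qed

lemma smooth_on_has_derivative: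
  assumes "smooth_on S f" "open S" "x \<in> S"
  shows "(f has_derivative frechet_derivative f (at x)) (at x)"
  using assms(1,3) Ck_on_Suc_has_derivative[of 0 S f x]
  unfolding smooth_on_open_iff[OF assms(2)] by blast

lemma smooth_on_frechet_derivative:
  assumes "smooth_on S f" "open S"
  shows "smooth_on S (\<lambda>x. frechet_derivative f (at x) v)"
  unfolding smooth_on_open_iff[OF assms(2)]
proof
  fix k
  have "Ck_on (Suc k) S f"
    using assms(1) unfolding smooth_on_open_iff[OF assms(2)] by blast
  then show "Ck_on k S (\<lambda>x. frechet_derivative f (at x) v)" by simp
qed

text \<open>
  This serves for functions known through their derivative, such as primitives.
\<close>

lemma smooth_onI_derivative:
  assumes "open S" and "\<And>x. x \<in> S \<Longrightarrow> (f has_derivative f' x) (at x)"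
    and "\<And>v. smooth_on S (\<lambda>x. f' x v)"
  shows "smooth_on S f"
proof -
  have "Ck_on (Suc k) S f" for k
    using assms(3) by (intro Ck_on_SucI[OF assms(1,2)]) (simp_all add: smooth_on_open_iff[OF assms(1)])
  then show ?thesis
    by (simp add: smooth_on_open_iff[OF assms(1)] Ck_on_Suc_imp_Ck_on del: Ck_on.simps(2))
qed

lemma smooth_on_compose:
  fixes f :: "'a::real_normed_vector \<Rightarrow> 'b::euclidean_space"
  assumes "smooth_on S' g" "smooth_on S f" "f ` S \<subseteq> S'"
  shows "smooth_on S (\<lambda>x. g (f x))"
  unfolding smooth_on_def
proof
  fix p assume p: "p \<in> S"
  then obtain U f1 where U: "open U" "p \<in> U" "\<And>k. Ck_on k U f1" "\<And>x. x \<in> U \<inter> S \<Longrightarrow> f1 x = f x"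
    using assms(2) unfolding smooth_on_def by meson
  obtain V g1 where V: "open V" "f p \<in> V" "\<And>k. Ck_on k V g1" "\<And>x. x \<in> V \<inter> S' \<Longrightarrow> g1 x = g x"
    using assms(1,3) p unfolding smooth_on_def by (metis image_subset_iff)
  define W where "W = U \<inter> f1 -` V"
  have "open W"
    using Ck_on_imp_continuous_on[OF U(3)] U(1) V(1) continuous_open_preimage
    unfolding W_def by blast
  moreover have "p \<in> W" using U V p by (auto simp: W_def)
  moreover have "Ck_on k W (\<lambda>x. g1 (f1 x))" for k
    by (rule Ck_on_compose[OF \<open>open W\<close>, of _ V]) (use U V in \<open>auto simp: W_def intro: Ck_on_subset\<close>)
  moreover have "\<forall>x\<in>W \<inter> S. g1 (f1 x) = g (f x)"
    using U V assms(3) by (auto simp: W_def)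
  ultimately show "\<exists>U h. open U \<and> p \<in> U \<and> (\<forall>k. Ck_on k U h) \<and> (\<forall>x\<in>U \<inter> S. h x = g (f x))"
    by blast
qed

lemma smooth_on_const: "smooth_on S (\<lambda>x. c)"
  by (rule smooth_on_subset[of UNIV]) (auto simp: smooth_on_open_iff Ck_on_const)

lemma smooth_on_linear: "bounded_linear f \<Longrightarrow> smooth_on S f"
  by (rule smooth_on_subset[of UNIV]) (auto simp: smooth_on_open_iff Ck_on_linear)

lemma smooth_on_linear_compose:
  fixes f :: "'a::real_normed_vector \<Rightarrow> 'b::euclidean_space"
  shows "bounded_linear L \<Longrightarrow> smooth_on S f \<Longrightarrow> smooth_on S (\<lambda>x. L (f x))"
  by (rule smooth_on_compose[of UNIV L]) (auto intro: smooth_on_linear)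

lemma smooth_on_bilinear:
  assumes "bounded_bilinear b" "smooth_on S f" "smooth_on S g"
  shows "smooth_on S (\<lambda>x. b (f x) (g x))"
  unfolding smooth_on_def
proof
  fix p assume p: "p \<in> S"
  then obtain U f1 where U: "open U" "p \<in> U" "\<And>k. Ck_on k U f1" "\<And>x. x \<in> U \<inter> S \<Longrightarrow> f1 x = f x"
    using assms(2) unfolding smooth_on_def by meson
  obtain V g1 where V: "open V" "p \<in> V" "\<And>k. Ck_on k V g1" "\<And>x. x \<in> V \<inter> S \<Longrightarrow> g1 x = g x"
    using p assms(3) unfolding smooth_on_def by meson
  have "Ck_on k (U \<inter> V) (\<lambda>x. b (f1 x) (g1 x))" for k
    using U V by (intro Ck_on_bilinear[OF _ assms(1)] Ck_on_subset[OF U(3)] Ck_on_subset[OF V(3)]) auto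
  then show "\<exists>U h. open U \<and> p \<in> U \<and> (\<forall>k. Ck_on k U h) \<and> (\<forall>x\<in>U \<inter> S. h x = b (f x) (g x))"
    using U V by (intro exI[of _ "U \<inter> V"] exI[of _ "\<lambda>x. b (f1 x) (g1 x)"]) auto
qed

lemma smooth_on_add:
  assumes "smooth_on S f" "smooth_on S g"
  shows "smooth_on S (\<lambda>x. f x + g x)"
  unfolding smooth_on_def
proof
  fix p assume p: "p \<in> S"
  then obtain U f1 where U: "open U" "p \<in> U" "\<And>k. Ck_on k U f1" "\<And>x. x \<in> U \<inter> S \<Longrightarrow> f1 x = f x"
    using assms(1) unfolding smooth_on_def by meson
  obtain V g1 where V: "open V" "p \<in> V" "\<And>k. Ck_on k V g1" "\<And>x. x \<in> V \<inter> S \<Longrightarrow> g1 x = g x"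
    using p assms(2) unfolding smooth_on_def by meson
  have "Ck_on k (U \<inter> V) (\<lambda>x. f1 x + g1 x)" for k
    using U V by (intro Ck_on_add Ck_on_subset[OF U(3)] Ck_on_subset[OF V(3)]) auto
  then show "\<exists>U h. open U \<and> p \<in> U \<and> (\<forall>k. Ck_on k U h) \<and> (\<forall>x\<in>U \<inter> S. h x = f x + g x)"
    using U V by (intro exI[of _ "U \<inter> V"] exI[of _ "\<lambda>x. f1 x + g1 x"]) auto
qed

lemmas smooth_on_mult = smooth_on_bilinear[OF bounded_bilinear_mult]
lemmas smooth_on_scaleR = smooth_on_bilinear[OF bounded_bilinear_scaleR]

lemma smooth_on_uminus:
  fixes f :: "'a::real_normed_vector \<Rightarrow> 'b::euclidean_space"
  shows "smooth_on S f \<Longrightarrow> smooth_on S (\<lambda>x. - f x)"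
  by (rule smooth_on_linear_compose) (simp_all add: bounded_linear_minus bounded_linear_ident)

lemma smooth_on_diff:
  fixes f :: "'a::real_normed_vector \<Rightarrow> 'b::euclidean_space"
  shows "smooth_on S f \<Longrightarrow> smooth_on S g \<Longrightarrow> smooth_on S (\<lambda>x. f x - g x)"
  using smooth_on_add[OF _ smooth_on_uminus, of S f g] by simp

lemma smooth_on_Pair:
  fixes f :: "'a::real_normed_vector \<Rightarrow> 'b::euclidean_space" and g :: "'a \<Rightarrow> 'c::euclidean_space"
  assumes "smooth_on S f" "smooth_on S g"
  shows "smooth_on S (\<lambda>x. (f x, g x))"
proof -
  have "bounded_linear (\<lambda>y::'b. (y, 0::'c))" "bounded_linear (\<lambda>y::'c. (0::'b, y))"
    by (intro bounded_linear_Pair bounded_linear_ident bounded_linear_zero)+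
  from this[THEN smooth_on_linear_compose] assms
  have "smooth_on S (\<lambda>x. (f x, 0) + (0, g x))"
    by (intro smooth_on_add)
  then show ?thesis by simp
qed

lemma smooth_on_exp:
  fixes f :: "'a::real_normed_vector \<Rightarrow> 'b::{euclidean_space,real_normed_field,banach}"
  assumes "smooth_on S f"
  shows "smooth_on S (\<lambda>x. exp (f x))"
proof -
  have "Ck_on k UNIV (exp :: 'b \<Rightarrow> 'b)" for k
  proof (induction k)
    case (Suc k)
    then show ?case
      by (intro Ck_on_SucI[where f' = "\<lambda>x v. exp x * v"] Ck_on_bilinear[OF _ bounded_bilinear_mult]
          Ck_on_const DERIV_exp[unfolded has_field_derivative_def]) auto
  qed (auto intro: continuous_on_exp)
  then show ?thesis
    using smooth_on_compose[OF _ assms, of UNIV exp] by (simp add: smooth_on_open_iff)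
qed

lemma smooth_on_inverse:
  fixes f :: "'a::real_normed_vector \<Rightarrow> 'b::{euclidean_space,real_normed_field}"
  assumes "smooth_on S f" and "\<And>x. x \<in> S \<Longrightarrow> f x \<noteq> 0"
  shows "smooth_on S (\<lambda>x. inverse (f x))"
proof -
  have "Ck_on k (- {0}) (inverse :: 'b \<Rightarrow> 'b)" for k
  proof (induction k)
    case (Suc k)
    have 1: "Ck_on k (- {0}) (\<lambda>x. (inverse x * inverse x) * (- v))" for v :: 'b
      by (intro Ck_on_bilinear[OF _ bounded_bilinear_mult] Suc Ck_on_const) auto
    show ?case
      by (intro Ck_on_SucI[where f' = "\<lambda>x v. (inverse x * inverse x) * (- v)"] 1)
        (auto intro!: derivative_eq_intros simp: mult_ac)
  qed (auto intro!: continuous_intros)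
  then show ?thesis
    using assms(2) by (intro smooth_on_compose[OF _ assms(1), of "- {0}"])
      (auto simp: smooth_on_open_iff[OF open_Compl[OF closed_singleton]])
qed

lemma smooth_on_divide:
  fixes f :: "'a::real_normed_vector \<Rightarrow> 'b::{euclidean_space,real_normed_field}"
  assumes "smooth_on S f" "smooth_on S g" and "\<And>x. x \<in> S \<Longrightarrow> g x \<noteq> 0"
  shows "smooth_on S (\<lambda>x. f x / g x)"
  using smooth_on_mult[OF assms(1) smooth_on_inverse[OF assms(2,3)]] by (simp add: divide_inverse)

lemma smooth_on_of_real: "smooth_on S f \<Longrightarrow> smooth_on S (\<lambda>x. complex_of_real (f x))"
  by (rule smooth_on_linear_compose) (rule bounded_linear_of_real)

lemma smooth_on_cis: "smooth_on S f \<Longrightarrow> smooth_on S (\<lambda>x. cis (f x))"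
  unfolding cis_conv_exp by (intro smooth_on_exp smooth_on_mult smooth_on_const smooth_on_of_real)

lemma smooth_on_cnj: "smooth_on S f \<Longrightarrow> smooth_on S (\<lambda>x. cnj (f x))"
  by (rule smooth_on_linear_compose) (rule bounded_linear_cnj)

lemma smooth_on_id: "smooth_on S (\<lambda>x. x)"
  by (rule smooth_on_linear) (rule bounded_linear_ident)

lemma smooth_on_fst:
  fixes f :: "'a::real_normed_vector \<Rightarrow> 'b::euclidean_space \<times> 'c::euclidean_space"
  shows "smooth_on S f \<Longrightarrow> smooth_on S (\<lambda>x. fst (f x))"
  by (rule smooth_on_linear_compose) (rule bounded_linear_fst)

lemma smooth_on_snd:
  fixes f :: "'a::real_normed_vector \<Rightarrow> 'b::euclidean_space \<times> 'c::euclidean_space"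
  shows "smooth_on S f \<Longrightarrow> smooth_on S (\<lambda>x. snd (f x))"
  by (rule smooth_on_linear_compose) (rule bounded_linear_snd)

lemmas smooth_on_intros = smooth_on_const smooth_on_id smooth_on_fst smooth_on_snd smooth_on_cis
  smooth_on_cnj smooth_on_of_real smooth_on_exp smooth_on_Pair smooth_on_add smooth_on_diff
  smooth_on_uminus smooth_on_mult smooth_on_scaleR

section \<open>A flat function\<close>

definition flat :: "real \<Rightarrow> real" where
  "flat x = (if x > 0 then exp (- inverse x) else 0)"

text \<open>
  All derivatives of \<open>flat\<close> are linear combinations of the functions \<open>x\<^sup>-\<^sup>n e\<^sup>-\<^sup>1\<^sup>/\<^sup>x\<close> for \<open>x > 0\<close>, extended by
  zero. It suffices that each of these is differentiable with a derivative of the same kind.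
\<close>

lemma flat_smooth:
  "smooth_on UNIV flat"
proof -
  define h where "h n x = (if x > 0 then inverse x ^ n * exp (- inverse x) else 0)" for n and x :: real
  have lim: "((\<lambda>x. inverse x ^ n * exp (- inverse x)) \<longlongrightarrow> (0::real)) (at_right 0)" for n
  proof -
    have "((\<lambda>x::real. inverse x ^ n / exp (inverse x)) \<longlongrightarrow> 0) (at_right 0)"
      by (rule filterlim_compose[OF tendsto_power_div_exp_0 filterlim_inverse_at_top_right])
    then show ?thesis by (simp add: exp_minus divide_inverse)
  qed
  have lim0: "(h n \<longlongrightarrow> 0) (at 0)" for n
  proof -
    have "(h n \<longlongrightarrow> 0) (at_right 0)"
      by (rule Lim_transform_eventually[OF lim[of n]])
        (auto simp: h_def eventually_at_right_field intro: exI[of _ 1])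
    moreover have "(h n \<longlongrightarrow> 0) (at_left 0)"
      by (rule tendsto_eventually) (auto simp: h_def eventually_at_left_field intro: exI[of _ "-1"])
    ultimately show ?thesis by (simp add: filterlim_split_at)
  qed
  have deriv: "(h n has_real_derivative h (n + 2) x - n * h (n + 1) x) (at x)" for n x
  proof (cases x "0::real" rule: linorder_cases)
    case less
    have "((\<lambda>x. 0) has_real_derivative 0) (at x)" by simp
    then have "(h n has_real_derivative 0) (at x)"
      by (rule has_field_derivative_transform_within_open[where S = "{..<0}"]) (use less in \<open>auto simp: h_def\<close>)
    then show ?thesis using less by (simp add: h_def)
  next
    case equal
    have "((\<lambda>y. (h n (0 + y) - h n 0) / y) \<longlongrightarrow> 0) (at 0)"
      by (rule Lim_transform_eventually[OF lim0[of "Suc n"]])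
        (auto simp: h_def eventually_at_filter field_simps)
    then show ?thesis using equal by (simp add: DERIV_def h_def)
  next
    case greater
    have "((\<lambda>x. inverse x ^ n * exp (- inverse x)) has_real_derivative
        (h (n + 2) x - n * h (n + 1) x)) (at x)"
      using greater
      by (auto intro!: derivative_eq_intros simp: h_def power2_eq_square)
        (cases n; auto simp: field_simps power_add)
    then show ?thesis
      by (rule has_field_derivative_transform_within_open[where S = "{0<..}"]) (use greater in \<open>auto simp: h_def\<close>)
  qed
  have "Ck_on k UNIV (h n)" for k n
  proof (induction k arbitrary: n)
    case 0
    show ?case by (auto intro!: continuous_at_imp_continuous_on DERIV_isCont[OF deriv])
  next
    case (Suc k)
    have "Ck_on k UNIV (\<lambda>x. (h (n + 2) x + (- real n) * h (n + 1) x) * v)" for v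
      by (intro Ck_on_bilinear[OF _ bounded_bilinear_mult] Suc Ck_on_const Ck_on_add) auto
    then show ?case
      by (intro Ck_on_SucI[where f' = "\<lambda>x v. (h (n + 2) x + (- real n) * h (n + 1) x) * v"])
        (use deriv in \<open>auto simp: has_field_derivative_def\<close>)
  qed
  moreover have "h 0 = flat" by (auto simp: h_def flat_def)
  ultimately show ?thesis by (metis smooth_on_open_iff[OF open_UNIV])
qed

lemma flat_pos_iff [simp]: "0 < flat x \<longleftrightarrow> 0 < x"
  by (simp add: flat_def)

lemma flat_eq_0 [simp]: "x \<le> 0 \<Longrightarrow> flat x = 0"
  by (simp add: flat_def)

lemma flat_neq_0 [simp]: "0 < x \<Longrightarrow> flat x \<noteq> 0"
  by (simp add: flat_def)

lemma flat_nonneg [simp]: "0 \<le> flat x"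
  by (simp add: flat_def)

lemma flat_strict_mono: "x < y \<Longrightarrow> 0 < y \<Longrightarrow> flat x < flat y"
  by (auto simp: flat_def less_imp_inverse_less)

section \<open>Complex linear algebra in the plane\<close>

definition cscale :: "complex \<Rightarrow> complex \<times> complex \<Rightarrow> complex \<times> complex" where
  "cscale a p = (a * fst p, a * snd p)"

text \<open>
  The determinant over the complex numbers: it vanishes exactly if the two vectors lie on one complex
  line.
\<close>

definition cdet :: "complex \<times> complex \<Rightarrow> complex \<times> complex \<Rightarrow> complex" where
  "cdet p q = fst p * snd q - snd p * fst q"

text \<open>
  Left multiplication by the quaternion \<open>j\<close>, which is antilinear: it chooses, for every nonzero vector,
  a vector that is complex independent of it.
\<close>

definition quat_j :: "complex \<times> complex \<Rightarrow> complex \<times> complex" where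
  "quat_j p = (- cnj (snd p), cnj (fst p))"

text \<open>
  The complex linear map that takes the standard basis to \<open>p\<close> and \<open>j p\<close>, a multiple of a matrix in
  \<open>SU(2)\<close>. It is invertible for every \<open>p \<noteq> 0\<close>, so that paths of nonzero vectors become paths of complex
  linear isomorphisms.
\<close>

definition frame_map :: "complex \<times> complex \<Rightarrow> complex \<times> complex \<Rightarrow> complex \<times> complex" where
  "frame_map p x = cscale (fst x) p + cscale (snd x) (quat_j p)"

lemma cscale_simps [simp]:
  "fst (cscale a p) = a * fst p" "snd (cscale a p) = a * snd p"
  "cscale 0 p = 0" "cscale a 0 = 0" "cscale 1 p = p"
  by (simp_all add: cscale_def zero_prod_def)

lemma quat_j_simps [simp]: "fst (quat_j p) = - cnj (snd p)" "snd (quat_j p) = cnj (fst p)"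
  by (simp_all add: quat_j_def)

lemma bounded_bilinear_cscale: "bounded_bilinear cscale"
proof
  show "\<exists>K. \<forall>a b. norm (cscale a b) \<le> norm a * norm b * K"
  proof (intro exI[of _ 1] allI)
    fix a :: complex and b :: "complex \<times> complex"
    have "norm (cscale a b) = norm a * norm b"
      by (simp add: cscale_def norm_prod_def norm_mult power_mult_distrib real_sqrt_mult
          flip: distrib_left)
    then show "norm (cscale a b) \<le> norm a * norm b * 1" by simp
  qed
qed (auto simp: cscale_def algebra_simps scaleR_prod_def)

lemma bounded_bilinear_cdet: "bounded_bilinear cdet"
proof
  show "\<exists>K. \<forall>a b. norm (cdet a b) \<le> norm a * norm b * K"
  proof (intro exI[of _ 2] allI)
    fix a b :: "complex \<times> complex"
    have n: "norm (fst x) \<le> norm x" "norm (snd x) \<le> norm x" for x :: "complex \<times> complex"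
      by (metis norm_fst_le norm_snd_le prod.collapse)+
    have "norm (cdet a b) \<le> norm (fst a) * norm (snd b) + norm (snd a) * norm (fst b)"
      unfolding cdet_def by (metis norm_mult norm_triangle_ineq4)
    also have "\<dots> \<le> norm a * norm b + norm a * norm b"
      by (intro add_mono mult_mono n) auto
    finally show "norm (cdet a b) \<le> norm a * norm b * 2" by simp
  qed
qed (auto simp: cdet_def algebra_simps)

lemma bounded_linear_quat_j: "bounded_linear quat_j"
  unfolding quat_j_def
  by (intro bounded_linear_Pair bounded_linear_minus
      bounded_linear_compose[OF bounded_linear_cnj] bounded_linear_fst bounded_linear_snd)

lemmas smooth_on_cscale = smooth_on_bilinear[OF bounded_bilinear_cscale]
lemmas smooth_on_cdet = smooth_on_bilinear[OF bounded_bilinear_cdet]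

lemma smooth_on_quat_j:
  fixes f :: "'a::real_normed_vector \<Rightarrow> complex \<times> complex"
  shows "smooth_on S f \<Longrightarrow> smooth_on S (\<lambda>x. quat_j (f x))"
  by (rule smooth_on_linear_compose) (rule bounded_linear_quat_j)

lemma smooth_on_frame_map:
  fixes f g :: "'a::real_normed_vector \<Rightarrow> complex \<times> complex"
  shows "smooth_on S f \<Longrightarrow> smooth_on S g \<Longrightarrow> smooth_on S (\<lambda>x. frame_map (f x) (g x))"
  unfolding frame_map_def
  by (intro smooth_on_add smooth_on_cscale smooth_on_quat_j smooth_on_fst smooth_on_snd)

lemma cdet_quat_j: "cdet p (quat_j p) = of_real ((norm p)\<^sup>2)"
  by (simp add: cdet_def norm_prod_def complex_mult_cnj cmod_power2)

lemma cdet_quat_j_eq_0_iff [simp]: "cdet p (quat_j p) = 0 \<longleftrightarrow> p = 0"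
  by (simp add: cdet_quat_j)

lemma cdet_self [simp]: "cdet p p = 0"
  by (simp add: cdet_def mult.commute)

lemma cdet_cscale [simp]: "cdet (cscale a p) q = a * cdet p q" "cdet p (cscale a q) = a * cdet p q"
  by (simp_all add: cdet_def algebra_simps)

lemma cdet_add [simp]: "cdet (p + p') q = cdet p q + cdet p' q" "cdet p (q + q') = cdet p q + cdet p q'"
  by (simp_all add: cdet_def algebra_simps)

lemma cdet_0 [simp]: "cdet 0 p = 0" "cdet p 0 = 0"
  by (simp_all add: cdet_def)

lemma scaleR_eq_cscale: "r *\<^sub>R p = cscale (of_real r) p"
  by (auto simp: cscale_def scaleR_prod_def prod_eq_iff scaleR_conv_of_real)

lemma cscale_cscale [simp]: "cscale a (cscale b p) = cscale (a * b) p"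
  by (simp add: cscale_def mult.assoc)

lemma quat_j_cscale [simp]: "quat_j (cscale a p) = cscale (cnj a) (quat_j p)"
  by (simp add: prod_eq_iff)

text \<open>
  The first coefficient is a normalized Hermitian product because \<open>p\<close> and \<open>j p\<close> are orthogonal.
\<close>

lemma frame_decomposition:
  assumes "p \<noteq> 0"
  shows "v = cscale ((fst v * cnj (fst p) + snd v * cnj (snd p)) / cdet p (quat_j p)) p
    + cscale (cdet p v / cdet p (quat_j p)) (quat_j p)"
proof -
  have "cdet p (quat_j p) \<noteq> 0" using assms by simp
  then show ?thesis
    by (simp add: prod_eq_iff field_simps) (simp add: cdet_def algebra_simps)
qed

lemma cdet_frame_map: "cdet (frame_map p x) (frame_map p y) = cdet p (quat_j p) * cdet x y"
  by (simp add: frame_map_def cdet_def algebra_simps)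

lemma bounded_linear_frame_map: "bounded_linear (frame_map p)"
  unfolding frame_map_def
  by (intro bounded_linear_add
      bounded_linear_compose[OF bounded_bilinear.bounded_linear_left[OF bounded_bilinear_cscale]]
      bounded_linear_fst bounded_linear_snd)

lemma frame_map_eq_iff:
  assumes "p \<noteq> 0"
  shows "frame_map p x = frame_map p y \<longleftrightarrow> x = y"
proof
  assume "frame_map p x = frame_map p y"
  then have "frame_map p (x - y) = 0"
    using linear_diff[OF bounded_linear.linear[OF bounded_linear_frame_map]] by simp
  then have "cdet (x - y) z = 0" for z
    using cdet_frame_map[of p "x - y" z] assms by auto
  from this[of "(0, 1)"] this[of "(1, 0)"] show "x = y"
    by (simp add: cdet_def prod_eq_iff)
qed simp

lemma cdet_nonzero_real_independent:
  assumes "cdet A B \<noteq> 0" and "a *\<^sub>R A + b *\<^sub>R B = 0"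
  shows "a = 0" "b = 0"
proof -
  have "cdet (a *\<^sub>R A + b *\<^sub>R B) B = 0" "cdet A (a *\<^sub>R A + b *\<^sub>R B) = 0"
    using assms(2) by simp_all
  then show "a = 0" "b = 0"
    using assms(1) by (simp_all add: scaleR_eq_cscale)
qed

section \<open>Tangent vectors of an embedded surface\<close>

text \<open>
  This identifies the tangent vectors of an embedded surface, which are velocities of arbitrary curves
  in the image, with the range of the derivative of a parametrization. By compactness the lifted
  curve \<open>x\<close> in \<open>K\<close> tends to \<open>q\<close>, since \<open>q\<close> is the only point of \<open>K\<close> over \<open>f q\<close>. A left inverse of \<open>D\<close> then
  bounds \<open>x h - q\<close> by a multiple of \<open>h\<close>, so that the remainder in \<open>f (x h) - f q - D (x h - q)\<close> is
  \<open>o(h)\<close>; hence \<open>v\<close> is a limit of vectors in the range of \<open>D\<close>, which is closed.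
\<close>

lemma velocity_in_range_derivative:
  fixes f :: "'a::euclidean_space \<Rightarrow> 'b::euclidean_space" and c :: "real \<Rightarrow> 'b"
  assumes f: "(f has_derivative D) (at q)" and "inj D"
    and K: "compact K" "q \<in> K" "continuous_on K f" and inj: "\<And>x. x \<in> K \<Longrightarrow> f x = f q \<Longrightarrow> x = q"
    and c: "range c \<subseteq> f ` K" "c 0 = f q" "(c has_vector_derivative v) (at 0)"
  shows "v \<in> range D"
proof -
  have "\<forall>h. \<exists>x. x \<in> K \<and> c h = f x" using c(1) by blast
  then obtain x where x: "\<And>h. x h \<in> K" "\<And>h. c h = f (x h)" by metis
  have "bounded_linear D" using f by (rule has_derivative_bounded_linear)
  then have "linear D" by (rule bounded_linear.linear)
  have "continuous (at 0) c"
    using c(3) by (rule has_vector_derivative_continuous)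
  then have c0: "((\<lambda>h. c h) \<longlongrightarrow> f q) (at 0)"
    using c(2) by (simp add: continuous_at)
  have x0: "(x \<longlongrightarrow> q) (at 0)"
    unfolding tendsto_def
  proof (intro allI impI)
    fix S assume S: "open S" "q \<in> S"
    have "compact (f ` (K - S))"
      using K S by (intro compact_continuous_image compact_diff) (auto intro: continuous_on_subset)
    moreover have "f q \<notin> f ` (K - S)"
      using inj S by force
    ultimately have "\<forall>\<^sub>F h in at 0. c h \<in> - f ` (K - S)"
      using c0 by (intro topological_tendstoD) (auto intro: compact_imp_closed)
    then show "\<forall>\<^sub>F h in at 0. x h \<in> S"
      by eventually_elim (use x in force)
  qed
  obtain P where P: "linear P" "P \<circ> D = id"
    using linear_injective_left_inverse[OF \<open>linear D\<close> \<open>inj D\<close>] by blast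
  have "bounded_linear P" using P(1) by (simp add: linear_conv_bounded_linear)
  obtain M where M: "M > 0" "\<And>y. norm (P y) \<le> norm y * M"
    using bounded_linear.pos_bounded[OF \<open>bounded_linear P\<close>] by blast
  define e where "e h = x h - q" for h
  define r where "r h = f (x h) - f q - D (e h)" for h
  have little: "\<forall>\<^sub>F h in at 0. norm (r h) \<le> \<delta> * norm (e h)" if pos: "\<delta> > 0" for \<delta>
  proof -
    obtain d where d: "d > 0" "\<And>y. norm (y - q) < d \<Longrightarrow> norm (f y - f q - D (y - q)) \<le> \<delta> * norm (y - q)"
      using f pos unfolding has_derivative_at_alt by blast
    have "\<forall>\<^sub>F h in at 0. dist (x h) q < d"
      using x0 d(1) by (rule tendstoD)
    then show ?thesis
      by eventually_elim (use d in \<open>simp add: dist_norm e_def r_def\<close>)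
  qed
  have cD: "((\<lambda>h. (c h - c 0) /\<^sub>R h) \<longlongrightarrow> v) (at 0)"
  proof -
    have "((\<lambda>h. norm (c h - c 0 - h *\<^sub>R v) / norm h) \<longlongrightarrow> 0) (at 0)"
      using c(3) by (simp add: has_vector_derivative_def has_derivative_at)
    moreover have "\<forall>\<^sub>F h in at (0::real). h \<noteq> 0"
      by (simp add: eventually_at_filter)
    then have "\<forall>\<^sub>F h in at 0. norm (c h - c 0 - h *\<^sub>R v) / norm h = norm ((c h - c 0) /\<^sub>R h - v)"
    proof eventually_elim
      case (elim h)
      have "(c h - c 0) /\<^sub>R h - v = (c h - c 0 - h *\<^sub>R v) /\<^sub>R h"
        using elim by (simp add: scaleR_diff_right)
      then show ?case by (simp add: divide_inverse mult.commute)
    qed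
    ultimately have "((\<lambda>h. norm ((c h - c 0) /\<^sub>R h - v)) \<longlongrightarrow> 0) (at 0)"
      by (rule Lim_transform_eventually)
    then show ?thesis
      by (rule LIM_zero_cancel[OF tendsto_norm_zero_cancel])
  qed
  have "((\<lambda>h. r h /\<^sub>R h) \<longlongrightarrow> 0) (at 0)"
  proof (rule tendstoI)
    fix \<epsilon> :: real assume "\<epsilon> > 0"
    \<comment> \<open>The first bound absorbs half of \<open>e h\<close> into the left-hand side, which gives \<open>norm (e h) \<le> 2 M norm (c h - c 0)\<close>;
      the second one turns this into the required estimate, as \<open>c h - c 0\<close> is at most \<open>(norm v + 1) \<bar>h\<bar>\<close>.\<close>
    define \<delta> where "\<delta> = min (1 / (2 * M)) (\<epsilon> / (2 * M * (norm v + 1)))"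
    have "\<delta> > 0" using M \<open>\<epsilon> > 0\<close> by (simp add: \<delta>_def add_nonneg_pos)
    have "\<forall>\<^sub>F h in at 0. dist ((c h - c 0) /\<^sub>R h) v < 1"
      using cD by (rule tendstoD) simp
    moreover have "\<forall>\<^sub>F h in at (0::real). h \<noteq> 0"
      by (simp add: eventually_at_filter)
    ultimately show "\<forall>\<^sub>F h in at 0. dist (r h /\<^sub>R h) 0 < \<epsilon>"
      using little[OF \<open>\<delta> > 0\<close>]
    proof eventually_elim
      case (elim h)
      have "P (D (e h)) = e h" using P(2) by (metis comp_apply id_apply)
      then have "e h = P (c h - c 0) - P (r h)"
        using x(2) c(2) by (simp add: r_def linear_diff[OF P(1)])
      then have "norm (e h) \<le> norm (P (c h - c 0)) + norm (P (r h))"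
        by (simp add: norm_triangle_ineq4)
      then have "norm (e h) \<le> norm (c h - c 0) * M + norm (r h) * M"
        using M(2)[of "c h - c 0"] M(2)[of "r h"] by linarith
      moreover have "norm (r h) * M \<le> norm (e h) / 2"
      proof -
        have "norm (r h) * M \<le> (\<delta> * norm (e h)) * M"
          using elim(3) M(1) by (intro mult_right_mono) auto
        also have "\<dots> = (\<delta> * M) * norm (e h)" by simp
        also have "\<dots> \<le> 1 / 2 * norm (e h)"
        proof (rule mult_right_mono)
          have "\<delta> * M \<le> 1 / (2 * M) * M" using M(1) by (intro mult_right_mono) (auto simp: \<delta>_def)
          then show "\<delta> * M \<le> 1 / 2" using M(1) by simp
        qed simp
        finally show ?thesis by simp
      qed
      ultimately have e: "norm (e h) \<le> 2 * M * norm (c h - c 0)" by (simp add: mult_ac)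
      have "norm ((c h - c 0) /\<^sub>R h) < norm v + 1"
        using elim(1) norm_triangle_ineq2[of "(c h - c 0) /\<^sub>R h" v] by (simp add: dist_norm)
      then have "norm (c h - c 0) < (norm v + 1) * \<bar>h\<bar>"
        using elim(2) by (simp add: divide_simps)
      have "norm (r h) \<le> \<delta> * (2 * M * norm (c h - c 0))"
        using elim(3) e \<open>\<delta> > 0\<close> by (meson less_imp_le mult_left_mono order_trans)
      also have "\<dots> < \<delta> * (2 * M * ((norm v + 1) * \<bar>h\<bar>))"
        using \<open>norm (c h - c 0) < _\<close> \<open>\<delta> > 0\<close> M(1) by simp
      also have "\<dots> = \<delta> * (2 * M * (norm v + 1)) * \<bar>h\<bar>" by simp
      also have "\<dots> \<le> \<epsilon> * \<bar>h\<bar>"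
      proof (rule mult_right_mono)
        have pos: "2 * M * (norm v + 1) > 0" using M(1) by (simp add: add_nonneg_pos)
        have "\<delta> * (2 * M * (norm v + 1)) \<le> \<epsilon> / (2 * M * (norm v + 1)) * (2 * M * (norm v + 1))"
          using pos by (intro mult_right_mono) (auto simp: \<delta>_def)
        then show "\<delta> * (2 * M * (norm v + 1)) \<le> \<epsilon>"
          using pos by (metis less_irrefl nonzero_eq_divide_eq)
      qed simp
      finally show ?case using elim(2) by (simp add: divide_simps)
    qed
  qed
  then have "((\<lambda>h. (c h - c 0) /\<^sub>R h - r h /\<^sub>R h) \<longlongrightarrow> v - 0) (at 0)"
    by (rule tendsto_diff[OF cD])
  moreover have "(c h - c 0) /\<^sub>R h - r h /\<^sub>R h = D (e h /\<^sub>R h)" for h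
    using x(2) c(2) linear_scale[OF \<open>linear D\<close>, of "inverse h" "e h"]
    by (simp add: r_def flip: scaleR_diff_right)
  ultimately have lim: "((\<lambda>h. D (e h /\<^sub>R h)) \<longlongrightarrow> v) (at 0)"
    by simp
  have "closed (range D)"
    using \<open>linear D\<close> by (simp add: closed_subspace linear_subspace_image)
  then show ?thesis
    by (rule Lim_in_closed_set[OF _ _ _ lim]) auto
qed

section \<open>Totally real tori\<close>

lemma cis_eq_iff_shift:
  "cis s = cis t \<longleftrightarrow> (\<exists>m::int. s = t + 2 * pi * of_int m)"
  by (metis (no_types) cis.simps complex_eq_iff sin_cos_eq_iff)

lemma unit_circle_cis: "norm z = 1 \<Longrightarrow> \<exists>\<theta>. z = cis \<theta>"
  using cis_Arg[of z] by (intro exI[of _ "Arg z"]) (cases "z = 0"; simp add: sgn_div_norm)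

lemma ex_shift_into_period: "\<exists>m::int. t + 2 * pi * of_int m \<in> {a..<a + 2 * pi}"
proof -
  obtain k :: int where "of_int k \<le> (t - a) / (2 * pi)" "(t - a) / (2 * pi) < of_int k + 1"
    using that[of "\<lfloor>(t - a) / (2 * pi)\<rfloor>"] by linarith
  then have "of_int k * (2 * pi) \<le> t - a" "t - a < (of_int k + 1) * (2 * pi)"
    by (simp_all add: field_simps)
  then show ?thesis
    by (intro exI[of _ "- k"]) (simp add: algebra_simps)
qed

lemma periodic_shift_int:
  fixes f :: "real \<Rightarrow> 'a" and p :: real
  assumes "\<And>t. f (t + p) = f t"
  shows "f (t + p * of_int m) = f t"
proof -
  have n: "f (t + p * of_nat n) = f t" for n t
  proof (induction n)
    case (Suc n)
    then show ?case using assms[of "t + p * of_nat n"] by (simp add: algebra_simps)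
  qed simp
  show ?thesis
  proof (cases m)
    case (nonneg n)
    then show ?thesis using n by simp
  next
    case (neg n)
    then have m: "real_of_int m = - of_nat (Suc n)" by simp
    have "t + p * of_int m + p * of_nat (Suc n) = t" unfolding m by (simp add: algebra_simps)
    then show ?thesis using n[of "t + p * of_int m" "Suc n"] by metis
  qed
qed

lemma torus_map_eq_iff:
  assumes per: "circle_periodic_on X f" and inj: "inj_on f ({0..<2 * pi} \<times> X)"
    and z: "z \<in> X" "z' \<in> X" and eq: "f (t, z) = f (t', z')"
  shows "cis t = cis t'" "z = z'"
proof -
  obtain m n :: int where mn: "t + 2 * pi * of_int m \<in> {0..<2 * pi}" "t' + 2 * pi * of_int n \<in> {0..<2 * pi}"
    using ex_shift_into_period[of _ 0] by (metis add_0)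
  have shift: "f (t + 2 * pi * of_int m, z) = f (t, z)" if "z \<in> X" for t m z
    using periodic_shift_int[of "\<lambda>t. f (t, z)" "2 * pi"] per that
    by (simp add: circle_periodic_on_def)
  have "(t + 2 * pi * of_int m, z) = (t' + 2 * pi * of_int n, z')"
    by (rule inj_onD[OF inj]) (use mn z shift eq in simp_all)
  then show "z = z'" "cis t = cis t'"
    unfolding cis_eq_iff_shift by (auto intro: exI[of _ "n - m"] simp: algebra_simps)
qed

lemma inj_on_torusI:
  assumes "\<And>t z t' z'. z \<in> X \<Longrightarrow> z' \<in> X \<Longrightarrow> f (t, z) = f (t', z') \<Longrightarrow> cis t = cis t' \<and> z = z'"
  shows "inj_on f ({0..<2 * pi} \<times> X)"
proof (rule inj_onI, clarify, rule conjI)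
  fix t z t' z'
  assume *: "t \<in> {0..<2 * pi}" "z \<in> X" "t' \<in> {0..<2 * pi}" "z' \<in> X" "f (t, z) = f (t', z')"
  show "z = z'" using assms[OF *(2,4,5)] by simp
  have "cis t = cis t'" using assms[OF *(2,4,5)] by simp
  then obtain m :: int where m: "t = t' + 2 * pi * of_int m"
    unfolding cis_eq_iff_shift by blast
  then have "\<bar>2 * pi * of_int m\<bar> < 2 * pi * 1" using *(1,3) by auto
  then have "\<bar>real_of_int m\<bar> < 1" by (simp add: abs_mult)
  then show "t = t'" using m by simp
qed

text \<open>
  By \<open>velocity_in_range_derivative\<close> every tangent vector of the torus is a real combination of \<open>A\<close> and \<open>B\<close>. If \<open>v\<close>
  and \<open>\<i> v\<close> are both such combinations, then comparing coefficients with respect to the complex basis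
  \<open>A, B\<close> shows that the real coefficients of \<open>\<i> v\<close> are \<open>\<i>\<close> times real numbers, hence zero.
\<close>

lemma totally_real_torusI:
  assumes emb: "torus_embedding f"
    and der: "\<And>t \<theta>. \<exists>A B. ((\<lambda>(t, \<theta>). f (t, cis \<theta>)) has_derivative
      (\<lambda>(\<tau>, \<eta>). \<tau> *\<^sub>R A + \<eta> *\<^sub>R B)) (at (t, \<theta>)) \<and> cdet A B \<noteq> 0"
  shows "totally_real_torus (boundary_image f)"
  unfolding totally_real_torus_def
proof (intro conjI ballI notI)
  show "\<exists>f'. torus_embedding f' \<and> boundary_image f' = boundary_image f"
    using emb by blast
next
  fix p assume p: "p \<in> boundary_image f"
    and ex: "\<exists>v. v \<noteq> 0 \<and> complex_line v \<subseteq> tangent_vectors (boundary_image f) p"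
  obtain v where v: "v \<noteq> 0" "complex_line v \<subseteq> tangent_vectors (boundary_image f) p"
    using ex by blast
  obtain t z where tz: "z \<in> sphere 0 1" "p = f (t, z)"
    using p by (auto simp: boundary_image_def)
  obtain \<theta> where \<theta>: "z = cis \<theta>" using tz(1) unit_circle_cis by auto
  define g where "g = (\<lambda>(t, \<theta>). f (t, cis \<theta>))"
  obtain A B where AB: "(g has_derivative (\<lambda>(\<tau>, \<eta>). \<tau> *\<^sub>R A + \<eta> *\<^sub>R B)) (at (t, \<theta>))" "cdet A B \<noteq> 0"
    using der unfolding g_def by blast
  let ?D = "\<lambda>(\<tau>, \<eta>). \<tau> *\<^sub>R A + \<eta> *\<^sub>R B"
  have "linear ?D" using AB(1) has_derivative_linear by blast
  have "inj ?D"
    unfolding linear_injective_0[OF \<open>linear ?D\<close>]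
    using cdet_nonzero_real_independent[OF AB(2)] by (auto simp: zero_prod_def)
  \<comment> \<open>A full period in each direction, centred at the given point, so that no other point of \<open>K\<close> represents
    the same point of the torus.\<close>
  define K where "K = {t - pi..t + pi} \<times> {\<theta> - pi..\<theta> + pi}"
  have "compact K" "(t, \<theta>) \<in> K" by (auto simp: K_def compact_Times)
  have "continuous_on K g"
    using emb smooth_on_imp_continuous_on continuous_on_subset
    unfolding torus_embedding_def g_def by blast
  have center: "s = t" if st: "cis s = cis t" "s \<in> {t - pi..t + pi}" for s t
  proof -
    obtain m :: int where m: "s = t + 2 * pi * of_int m"
      using st(1) unfolding cis_eq_iff_shift by blast
    then have "\<bar>2 * pi * of_int m\<bar> < 2 * pi * 1"
      using st(2) pi_gt_zero unfolding atLeastAtMost_iff by arith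
    then have "\<bar>real_of_int m\<bar> < 1" by (simp add: abs_mult)
    then show "s = t" using m by simp
  qed
  have inj: "x = (t, \<theta>)" if x: "x \<in> K" "g x = g (t, \<theta>)" for x
  proof -
    obtain s \<eta> where [simp]: "x = (s, \<eta>)" by (cases x)
    have "cis s = cis t" "cis \<eta> = cis \<theta>"
      using torus_map_eq_iff[of "sphere 0 1" f "cis \<eta>" "cis \<theta>" s t] emb x(2)
      by (auto simp: torus_embedding_def g_def)
    then show ?thesis using center x(1) by (auto simp: K_def)
  qed
  have img: "boundary_image f \<subseteq> g ` K"
  proof
    fix y assume "y \<in> boundary_image f"
    then obtain s z' where "z' \<in> sphere 0 1" "y = f (s, z')"
      by (auto simp: boundary_image_def)
    then obtain \<eta> where y: "y = f (s, cis \<eta>)" using unit_circle_cis by fastforce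
    obtain m n :: int where mn: "s + 2 * pi * of_int m \<in> {t - pi..<t - pi + 2 * pi}"
      "\<eta> + 2 * pi * of_int n \<in> {\<theta> - pi..<\<theta> - pi + 2 * pi}"
      using ex_shift_into_period by meson
    have "y = g (s + 2 * pi * of_int m, \<eta> + 2 * pi * of_int n)"
    proof -
      have "cis (\<eta> + 2 * pi * of_int n) = cis \<eta>" unfolding cis_eq_iff_shift by blast
      moreover have "f (s + 2 * pi * of_int m, cis \<eta>) = f (s, cis \<eta>)"
        using periodic_shift_int[of "\<lambda>s. f (s, cis \<eta>)" "2 * pi"] emb
        by (simp add: circle_periodic_on_def torus_embedding_def)
      ultimately show ?thesis using y by (simp add: g_def)
    qed
    then show "y \<in> g ` K" by (rule image_eqI) (use mn in \<open>auto simp: K_def\<close>)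
  qed
  have tang: "w \<in> range ?D" if w: "w \<in> tangent_vectors (boundary_image f) p" for w
  proof -
    obtain c :: "real \<Rightarrow> _" where c: "range c \<subseteq> boundary_image f" "c 0 = p"
      "(c has_vector_derivative w) (at 0)"
      using w unfolding tangent_vectors_def by blast
    show ?thesis
      by (rule velocity_in_range_derivative[OF AB(1) \<open>inj ?D\<close> \<open>compact K\<close> \<open>(t, \<theta>) \<in> K\<close>
            \<open>continuous_on K g\<close> inj _ _ c(3)])
        (use c(1,2) img tz(2) \<theta> in \<open>auto simp: g_def\<close>)
  qed
  have "cscale 1 v \<in> complex_line v" "cscale \<i> v \<in> complex_line v"
    unfolding complex_line_def cscale_def by blast+
  then have "v \<in> tangent_vectors (boundary_image f) p" "cscale \<i> v \<in> tangent_vectors (boundary_image f) p"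
    using v(2) by auto
  then have "v \<in> range ?D" "cscale \<i> v \<in> range ?D" by (intro tang; simp)+
  then obtain a b a' b' where ab: "v = a *\<^sub>R A + b *\<^sub>R B" "cscale \<i> v = a' *\<^sub>R A + b' *\<^sub>R B"
    by auto
  have "cdet (cscale \<i> v) B = \<i> * cdet v B" "cdet A (cscale \<i> v) = \<i> * cdet A v" by simp_all
  then have "of_real a' = \<i> * of_real a" "of_real b' = \<i> * of_real b"
    unfolding ab(2) unfolding ab(1) using AB(2) by (simp_all add: scaleR_eq_cscale)
  then have "a = 0" "b = 0" by (auto simp: complex_eq_iff)
  then show False using v(1) ab(1) by simp
qed

section \<open>A linear isotopy to a round circle\<close>

lemma smooth_on_imp_differentiable_on: "smooth_on S f \<Longrightarrow> open S \<Longrightarrow> f differentiable_on S"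
  unfolding differentiable_on_def differentiable_def
  by (blast intro: smooth_on_has_derivative has_derivative_at_withinI)

text \<open>
  There are no knots in four dimensions, in the following explicit form. A collision of the points at
  \<open>t\<close> and \<open>t'\<close> at the time \<open>s\<close> means \<open>w = - \<mu> (\<gamma> t - \<gamma> t') / (e\<^sup>i\<^sup>t - e\<^sup>i\<^sup>t\<^sup>')\<close> with \<open>\<mu> = (1 - s) / s\<close>; the division
  makes sense because the target circle \<open>e\<^sup>i\<^sup>t w\<close> depends on \<open>w\<close> through a complex scalar. So \<open>w\<close> lies in
  the image of a smooth map with the three parameters \<open>\<mu>, t, t'\<close>, a null set. In the same way, a zero
  of the velocity places \<open>w\<close> in the image of a smooth map with two parameters.
\<close>

lemma generic_circle:
  fixes \<gamma> \<gamma>' :: "real \<Rightarrow> complex \<times> complex"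
  assumes smooth: "smooth_on UNIV \<gamma>" "smooth_on UNIV \<gamma>'"
    and nz: "\<And>t. \<gamma>' t \<noteq> 0"
    and inj: "\<And>t t'. \<gamma> t = \<gamma> t' \<Longrightarrow> cis t = cis t'"
  obtains w where "snd w \<noteq> 0"
    and "\<And>s t t'. s \<in> {0..1} \<Longrightarrow>
        (1 - s) *\<^sub>R \<gamma> t + s *\<^sub>R cscale (cis t) w = (1 - s) *\<^sub>R \<gamma> t' + s *\<^sub>R cscale (cis t') w \<Longrightarrow>
        cis t = cis t'"
    and "\<And>s t. s \<in> {0..1} \<Longrightarrow> (1 - s) *\<^sub>R \<gamma>' t + s *\<^sub>R cscale (\<i> * cis t) w \<noteq> 0"
proof -
  define A where "A = {x :: real \<times> real \<times> real. cis (fst (snd x)) - cis (snd (snd x)) \<noteq> 0}"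
  define f where "f x = cscale (- of_real (fst x) * inverse (cis (fst (snd x)) - cis (snd (snd x))))
    (\<gamma> (fst (snd x)) - \<gamma> (snd (snd x)))" for x :: "real \<times> real \<times> real"
  define g where "g x = cscale (- of_real (fst x) * inverse (\<i> * cis (snd x))) (\<gamma>' (snd x))"
    for x :: "real \<times> real"
  have "open A" unfolding A_def by (intro open_Collect_neq continuous_intros)
  have "smooth_on A f" unfolding f_def
    by (intro smooth_on_intros smooth_on_inverse smooth_on_cscale smooth_on_compose[OF smooth(1)])
      (auto simp: A_def)
  then have "negligible (f ` A)"
    using \<open>open A\<close> by (intro negligible_differentiable_image_lowdim smooth_on_imp_differentiable_on) auto
  moreover have "smooth_on UNIV g" unfolding g_def
    by (intro smooth_on_intros smooth_on_inverse smooth_on_cscale smooth_on_compose[OF smooth(2)]) auto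
  then have "negligible (range g)"
    by (intro negligible_differentiable_image_lowdim smooth_on_imp_differentiable_on) auto
  moreover have "open {w :: complex \<times> complex. snd w \<noteq> 0}"
    by (intro open_Collect_neq continuous_intros)
  then have "\<not> negligible {w :: complex \<times> complex. snd w \<noteq> 0}"
    by (rule open_not_negligible) (auto intro: exI[of _ 1])
  ultimately have "\<not> {w :: complex \<times> complex. snd w \<noteq> 0} \<subseteq> f ` A \<union> range g"
    using negligible_Un negligible_subset by blast
  then obtain w where w: "snd w \<noteq> 0" "w \<notin> f ` A" "w \<notin> range g" by blast
  show ?thesis
  proof (rule that[OF w(1)])
    fix s t t' :: real
    assume s: "s \<in> {0..1}"
      and eq: "(1 - s) *\<^sub>R \<gamma> t + s *\<^sub>R cscale (cis t) w = (1 - s) *\<^sub>R \<gamma> t' + s *\<^sub>R cscale (cis t') w"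
    show "cis t = cis t'"
    proof (rule ccontr)
      assume ne: "cis t \<noteq> cis t'"
      show False
      proof (cases "s = 0")
        case True
        then show False using eq inj[of t t'] ne by simp
      next
        case False
        let ?c = "cis t - cis t'"
        have 1: "cscale (of_real (1 - s)) (\<gamma> t - \<gamma> t') + cscale (of_real s * ?c) w = 0"
          using eq by (simp add: scaleR_eq_cscale prod_eq_iff algebra_simps)
        have "w = f ((1 - s) / s, t, t')"
          using 1 ne False
          by (simp add: f_def prod_eq_iff field_simps)
        moreover have "((1 - s) / s, t, t') \<in> A" using ne by (simp add: A_def)
        ultimately show False using w(2) by blast
      qed
    qed
  next
    fix s t :: real
    assume s: "s \<in> {0..1}"
    show "(1 - s) *\<^sub>R \<gamma>' t + s *\<^sub>R cscale (\<i> * cis t) w \<noteq> 0"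
    proof
      assume eq: "(1 - s) *\<^sub>R \<gamma>' t + s *\<^sub>R cscale (\<i> * cis t) w = 0"
      show False
      proof (cases "s = 0")
        case True
        then show False using eq nz by simp
      next
        case False
        let ?c = "\<i> * cis t"
        have 1: "cscale (of_real (1 - s)) (\<gamma>' t) + cscale (of_real s * ?c) w = 0"
          using eq by (simp add: scaleR_eq_cscale)
        have "w = g ((1 - s) / s, t)"
          using 1 False
          by (simp add: g_def prod_eq_iff field_simps)
        then show False using w(3) by blast
      qed
    qed
  qed
qed

section \<open>Periodic logarithms and framings\<close>

lemma smooth_on_real_has_vector_derivative:
  fixes f :: "real \<Rightarrow> 'a::real_normed_vector"
  assumes "smooth_on S f" "open S" "t \<in> S"
  shows "(f has_vector_derivative frechet_derivative f (at t) 1) (at t)"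
proof -
  have *: "(f has_derivative frechet_derivative f (at t)) (at t)"
    using assms by (rule smooth_on_has_derivative)
  have "frechet_derivative f (at t) = (\<lambda>h. h *\<^sub>R frechet_derivative f (at t) 1)"
  proof
    fix h
    show "frechet_derivative f (at t) h = h *\<^sub>R frechet_derivative f (at t) 1"
      using linear_scale[OF has_derivative_linear[OF *], of h 1] by simp
  qed
  with * show ?thesis unfolding has_vector_derivative_def by metis
qed

text \<open>
  The logarithm is a primitive of \<open>\<beta>' / \<beta>\<close>, and this is why it is smooth. Over one period it increases by
  a constant multiple \<open>m\<close> of \<open>2 \<pi> \<i>\<close>, the winding number, which the factor \<open>e\<^sup>i\<^sup>m\<^sup>t\<close> removes.
\<close>

lemma smooth_periodic_log:
  fixes \<beta> :: "real \<Rightarrow> complex"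
  assumes smooth: "smooth_on UNIV \<beta>" and nz: "\<And>t. \<beta> t \<noteq> 0"
    and per: "\<And>t. \<beta> (t + 2 * pi) = \<beta> t"
  obtains m :: int and g where "smooth_on UNIV g" "\<And>t. g (t + 2 * pi) = g t"
    "\<And>t. \<beta> t = cis (of_int m * t) * exp (g t)"
proof -
  define \<phi> where "\<phi> t = frechet_derivative \<beta> (at t) 1 / \<beta> t" for t
  have d\<beta>: "(\<beta> has_vector_derivative \<phi> t * \<beta> t) (at t)" for t
    using smooth_on_real_has_vector_derivative[OF smooth] nz by (simp add: \<phi>_def)
  have s\<phi>: "smooth_on UNIV \<phi>" unfolding \<phi>_def
    by (intro smooth_on_divide smooth_on_frechet_derivative smooth nz) auto
  then have "isCont \<phi> t" for t
    using smooth_on_imp_continuous_on continuous_on_eq_continuous_at by blast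
  then obtain G where G: "\<And>t. (G has_vector_derivative \<phi> t) (at t)"
    using einterval_antiderivative[of "-\<infinity>" "\<infinity>" \<phi>] by auto
  have "((\<lambda>t. exp (- G t) * \<beta> t) has_vector_derivative 0) (at t)" for t
  proof -
    have "((\<lambda>t. exp (- G t)) has_vector_derivative (- \<phi> t * exp (- G t))) (at t)"
      using field_vector_diff_chain_at[OF has_vector_derivative_minus[OF G] DERIV_exp] by (simp add: o_def)
    from has_vector_derivative_mult[OF this d\<beta>] show ?thesis by (simp add: algebra_simps)
  qed
  then obtain c where c: "\<And>t. exp (- G t) * \<beta> t = c"
    using has_vector_derivative_zero_constant[of UNIV "\<lambda>t. exp (- G t) * \<beta> t"] by auto
  have "c \<noteq> 0" using c[of 0] nz[of 0] by auto
  define g1 where "g1 t = G t + Ln c" for t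
  have e1: "\<beta> t = exp (g1 t)" for t
    using c[of t] \<open>c \<noteq> 0\<close> by (simp add: g1_def exp_add exp_minus field_simps)
  have d1: "(g1 has_vector_derivative \<phi> t) (at t)" for t
    unfolding g1_def by (auto intro!: derivative_eq_intros G)
  have s1: "smooth_on UNIV g1"
    by (rule smooth_onI_derivative[where f' = "\<lambda>t v. v *\<^sub>R \<phi> t"])
      (use d1 in \<open>auto simp: has_vector_derivative_def intro!: smooth_on_intros s\<phi>\<close>)
  define D where "D t = g1 (t + 2 * pi) - g1 t" for t
  have "exp (D t) = 1" for t
    using e1[of t] e1[of "t + 2 * pi"] per[of t] nz[of t] by (simp add: D_def exp_diff)
  have dD: "(D has_vector_derivative (\<phi> (t + 2 * pi) - \<phi> t)) (at t)" for t
  proof -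
    have "((\<lambda>t. g1 (t + 2 * pi)) has_vector_derivative \<phi> (t + 2 * pi)) (at t)"
    proof -
      have "((\<lambda>t. t + 2 * pi) has_real_derivative 1) (at t)"
        by (auto intro!: derivative_eq_intros)
      then show ?thesis
        using vector_diff_chain_at[of "\<lambda>t. t + 2 * pi" 1 t g1 "\<phi> (t + 2 * pi)"] d1
        by (simp add: o_def has_real_derivative_iff_has_vector_derivative)
    qed
    then show ?thesis unfolding D_def by (intro has_vector_derivative_diff d1)
  qed
  have "\<phi> (t + 2 * pi) - \<phi> t = 0" for t
  proof -
    have "((\<lambda>t. exp (D t)) has_vector_derivative (\<phi> (t + 2 * pi) - \<phi> t) * exp (D t)) (at t)"
      using field_vector_diff_chain_at[OF dD DERIV_exp] by (simp add: o_def)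
    then have "((\<lambda>t. 1) has_vector_derivative (\<phi> (t + 2 * pi) - \<phi> t)) (at t)"
      using \<open>\<And>t. exp (D t) = 1\<close> by simp
    then show ?thesis
      using vector_derivative_unique_at has_vector_derivative_const by blast
  qed
  then obtain d where d: "\<And>t. D t = d"
    using has_vector_derivative_zero_constant[of UNIV D] dD by auto
  have "exp d = 1" using \<open>\<And>t. exp (D t) = 1\<close>[of 0] d by simp
  then obtain m :: int where m: "d = \<i> * (of_int m * (2 * pi))"
    unfolding exp_eq_1 by (auto simp: complex_eq_iff mult_ac)
  show ?thesis
  proof (rule that[of "\<lambda>t. g1 t - \<i> * of_real (of_int m * t)" m])
    show "smooth_on UNIV (\<lambda>t. g1 t - \<i> * of_real (of_int m * t))"
      by (intro smooth_on_intros s1)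
    show "g1 (t + 2 * pi) - \<i> * of_real (of_int m * (t + 2 * pi)) = g1 t - \<i> * of_real (of_int m * t)" for t
      using d[of t] m by (simp add: D_def algebra_simps)
    show "\<beta> t = cis (of_int m * t) * exp (g1 t - \<i> * of_real (of_int m * t))" for t
      using e1[of t] by (simp add: cis_conv_exp flip: exp_add)
  qed
qed

lemma cis_int_mult_period: "cis (of_int m * (t + 2 * pi)) = cis (of_int m * t)"
  unfolding cis_eq_iff_shift by (intro exI[of _ m]) (simp add: algebra_simps)

text \<open>
  The initial frame is \<open>v = \<alpha> \<gamma>' + \<beta> \<i> e\<^sup>i\<^sup>t j \<gamma>'\<close> with \<open>\<beta> = e\<^sup>i\<^sup>m\<^sup>t e\<^sup>g\<close>. While \<open>\<gamma>'\<close> moves to the velocity \<open>\<i> e\<^sup>i\<^sup>t w\<close> of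
  the round circle, \<open>\<alpha>\<close> and the periodic function \<open>g\<close> are scaled to zero. The determinant stays a
  nonvanishing multiple of the squared norm of the velocity. The factor \<open>\<i> e\<^sup>i\<^sup>t\<close> is there because \<open>j\<close> is
  antilinear: it cancels the conjugate factor in \<open>j (\<i> e\<^sup>i\<^sup>t w)\<close>.
\<close>

lemma framing_homotopy:
  fixes \<gamma>' v :: "real \<Rightarrow> complex \<times> complex"
  assumes smooth: "smooth_on UNIV \<gamma>'" "smooth_on UNIV v"
    and per: "\<And>t. \<gamma>' (t + 2 * pi) = \<gamma>' t" "\<And>t. v (t + 2 * pi) = v t"
    and det: "\<And>t. cdet (\<gamma>' t) (v t) \<noteq> 0"
    and nz: "\<And>s t. s \<in> {0..1} \<Longrightarrow> (1 - s) *\<^sub>R \<gamma>' t + s *\<^sub>R cscale (\<i> * cis t) w \<noteq> 0"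
  obtains m :: int and V :: "real \<Rightarrow> real \<Rightarrow> complex \<times> complex"
  where "smooth_on UNIV (\<lambda>x. V (fst x) (snd x))"
    and "\<And>s t. V s (t + 2 * pi) = V s t"
    and "\<And>t. V 0 t = v t"
    and "\<And>t. V 1 t = cscale (cis (of_int m * t)) (quat_j w)"
    and "\<And>s t. s \<in> {0..1} \<Longrightarrow>
      cdet ((1 - s) *\<^sub>R \<gamma>' t + s *\<^sub>R cscale (\<i> * cis t) w) (V s t) \<noteq> 0"
proof -
  have nz0: "\<gamma>' t \<noteq> 0" for t using det[of t] by auto
  define u where "u s t = (1 - s) *\<^sub>R \<gamma>' t + s *\<^sub>R cscale (\<i> * cis t) w" for s t
  define \<alpha> where "\<alpha> t = (fst (v t) * cnj (fst (\<gamma>' t)) + snd (v t) * cnj (snd (\<gamma>' t)))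
    / cdet (\<gamma>' t) (quat_j (\<gamma>' t))" for t
  define \<beta> where "\<beta> t = cdet (\<gamma>' t) (v t) / (\<i> * cis t * cdet (\<gamma>' t) (quat_j (\<gamma>' t)))" for t
  have "smooth_on UNIV \<beta>" unfolding \<beta>_def
    by (intro smooth_on_divide smooth_on_intros smooth_on_cdet smooth_on_quat_j smooth) (use nz0 in auto)
  moreover have "\<beta> t \<noteq> 0" for t using det nz0 by (simp add: \<beta>_def)
  moreover have "\<beta> (t + 2 * pi) = \<beta> t" for t
    using per cis_int_mult_period[of 1 t] by (simp add: \<beta>_def)
  ultimately obtain m g where g: "smooth_on UNIV g" "\<And>t. g (t + 2 * pi) = g t"
    "\<And>t. \<beta> t = cis (of_int m * t) * exp (g t)"
    by (rule smooth_periodic_log) blast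
  define b where "b s t = cis (of_int m * t) * exp (of_real (1 - s) * g t) * (\<i> * cis t)" for s t
  define V where "V s t = cscale (of_real (1 - s) * \<alpha> t) (u s t) + cscale (b s t) (quat_j (u s t))" for s t
  show ?thesis
  proof (rule that[of V m])
    have \<alpha>: "smooth_on UNIV \<alpha>" unfolding \<alpha>_def
      by (intro smooth_on_divide smooth_on_intros smooth_on_cdet smooth_on_quat_j smooth) (use nz0 in auto)
    show "smooth_on UNIV (\<lambda>x. V (fst x) (snd x))"
      unfolding V_def u_def b_def
      by (intro smooth_on_intros smooth_on_cscale smooth_on_quat_j smooth_on_compose[OF \<alpha>]
          smooth_on_compose[OF g(1)] smooth_on_compose[OF smooth(1)]) auto
    show "V s (t + 2 * pi) = V s t" for s t
      using per cis_int_mult_period[of m t] cis_int_mult_period[of 1 t] g(2)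
      by (simp add: V_def u_def b_def \<alpha>_def)
    show "V 0 t = v t" for t
    proof -
      have "b 0 t = cdet (\<gamma>' t) (v t) / cdet (\<gamma>' t) (quat_j (\<gamma>' t))"
      proof -
        have "b 0 t = \<beta> t * (\<i> * cis t)" using g(3)[of t] by (simp add: b_def)
        also have "\<dots> = cdet (\<gamma>' t) (v t) / cdet (\<gamma>' t) (quat_j (\<gamma>' t))"
          by (simp add: \<beta>_def)
        finally show ?thesis .
      qed
      then show ?thesis
        using frame_decomposition[OF nz0, of "v t" t] by (simp add: V_def u_def \<alpha>_def)
    qed
    show "V 1 t = cscale (cis (of_int m * t)) (quat_j w)" for t
    proof -
      have "x * (\<i> * c) * cnj (\<i> * c) = x * (c * cnj c)" for x c
        by (simp add: complex_eq_iff algebra_simps)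
      then have "cis (of_int m * t) * (\<i> * cis t) * cnj (\<i> * cis t)
          = cis (of_int m * t) * (cis t * cis (- t))"
        by (simp only: cis_cnj)
      also have "\<dots> = cis (of_int m * t)" by (simp only: cis_mult) simp
      finally show ?thesis by (simp add: V_def u_def b_def)
    qed
    show "cdet ((1 - s) *\<^sub>R \<gamma>' t + s *\<^sub>R cscale (\<i> * cis t) w) (V s t) \<noteq> 0" if "s \<in> {0..1}" for s t
      using nz[OF that, of t] by (simp add: V_def b_def flip: u_def)
  qed
qed

section \<open>Uniform tubular neighbourhoods\<close>

lemma isCont_imp_tendsto_nhds: "isCont f a \<Longrightarrow> f a = b \<Longrightarrow> (f \<longlongrightarrow> b) (nhds a)"
  by (metis continuous_at tendsto_at_iff_tendsto_nhds)

text \<open>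
  In finite dimensions the convergence of \<open>D f x b\<close> to \<open>D f a b\<close> for the basis vectors \<open>b\<close> already implies
  convergence in the operator norm, and local injectivity follows as in the inverse function theorem.
\<close>

lemma smooth_locally_injective:
  fixes f :: "'a::euclidean_space \<Rightarrow> 'b::euclidean_space"
  assumes f: "smooth_on S f" "open S" "a \<in> S" and inj: "inj (frechet_derivative f (at a))"
  obtains r where "r > 0" "ball a r \<subseteq> S" "inj_on f (ball a r)"
proof -
  let ?f' = "\<lambda>x. frechet_derivative f (at x)"
  have d: "(f has_derivative ?f' x) (at x)" if "x \<in> S" for x
    using f(1,2) that by (rule smooth_on_has_derivative)
  obtain P where P: "linear P" "P \<circ> ?f' a = id"
    using linear_injective_left_inverse[OF has_derivative_linear[OF d[OF f(3)]] inj] by blast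
  have bound: "onorm (\<lambda>v. ?f' x v - ?f' a v) \<le> (\<Sum>b\<in>Basis. norm (?f' x b - ?f' a b))" if "x \<in> S" for x
  proof (rule onorm_bound)
    fix v :: 'a
    have lin: "linear (\<lambda>v. ?f' x v - ?f' a v)"
      using linear_compose_sub[OF has_derivative_linear[OF d[OF that]] has_derivative_linear[OF d[OF f(3)]]] .
    have "?f' x v - ?f' a v = (\<Sum>b\<in>Basis. (v \<bullet> b) *\<^sub>R (?f' x b - ?f' a b))"
      using linear_sum[OF lin, of "\<lambda>b. (v \<bullet> b) *\<^sub>R b" Basis] linear_scale[OF lin]
      by (simp add: euclidean_representation)
    then have "norm (?f' x v - ?f' a v) = norm (\<Sum>b\<in>Basis. (v \<bullet> b) *\<^sub>R (?f' x b - ?f' a b))"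
      by simp
    also have "\<dots> \<le> (\<Sum>b\<in>Basis. norm (?f' x b - ?f' a b) * norm v)"
      by (intro sum_norm_le) (simp add: Basis_le_norm mult.commute mult_right_mono)
    finally show "norm (?f' x v - ?f' a v) \<le> (\<Sum>b\<in>Basis. norm (?f' x b - ?f' a b)) * norm v"
      by (simp add: sum_distrib_right)
  qed (simp add: sum_nonneg)
  show ?thesis
  proof (rule has_derivative_locally_injective[where f = f and f' = ?f' and a = a and S = S and g' = P])
    show "bounded_linear P" using P(1) by (simp add: linear_conv_bounded_linear)
    show "\<And>x. x \<in> S \<Longrightarrow> (f has_derivative ?f' x) (at x)" by (rule d)
    show "\<exists>d>0. \<forall>x. dist a x < d \<longrightarrow> onorm (\<lambda>v. ?f' x v - ?f' a v) < e" if "e > 0" for e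
    proof -
      have "isCont (\<lambda>x. ?f' x b) a" for b
        using smooth_on_imp_continuous_on[OF smooth_on_frechet_derivative[OF f(1,2)]] f(2,3)
          continuous_on_eq_continuous_at by blast
      then have "isCont (\<lambda>x. \<Sum>b\<in>Basis. norm (?f' x b - ?f' a b)) a"
        by (intro continuous_intros)
      then have "\<forall>\<^sub>F x in nhds a. (\<Sum>b\<in>Basis. norm (?f' x b - ?f' a b)) < e"
        using \<open>e > 0\<close> by (intro order_tendstoD(2)[OF isCont_imp_tendsto_nhds]) auto
      moreover have "\<forall>\<^sub>F x in nhds a. x \<in> S" using f(2,3) by (rule eventually_nhds_in_open)
      ultimately have "\<forall>\<^sub>F x in nhds a. onorm (\<lambda>v. ?f' x v - ?f' a v) < e"
        by eventually_elim (use bound in fastforce)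
      then show ?thesis
        unfolding eventually_nhds_metric by (auto simp: dist_commute)
    qed
  qed (use f(2,3) P(2) that in auto)
qed

lemma eventually_nhds_uniform:
  assumes "compact K" and "\<And>k. k \<in> K \<Longrightarrow> \<forall>\<^sub>F p in nhds (x, k). P p"
  shows "\<forall>\<^sub>F y in nhds x. \<forall>k\<in>K. P (y, k)"
proof -
  have "{x} \<times> K \<subseteq> interior {p. P p}"
  proof clarify
    fix k assume "k \<in> K"
    then show "(x, k) \<in> interior {p. P p}"
      using assms(2)[of k] unfolding eventually_nhds interior_def by auto
  qed
  from Elementary_Topology.tube_lemma[OF assms(1) open_interior this] obtain X where
    X: "x \<in> X" "open X" "X \<times> K \<subseteq> interior {p. P p}" by blast
  have "X \<times> K \<subseteq> {p. P p}" using X(3) interior_subset by blast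
  then show ?thesis unfolding eventually_nhds using X(1,2) by blast
qed

text \<open>
  This transports derivatives of a periodic map from one period to another.
\<close>

lemma has_derivative_at_translate:
  assumes "open S" "x \<in> S" and f: "(f has_derivative f') (at (x + p))"
    and shift: "\<And>y. y \<in> S \<Longrightarrow> f (y + p) = f y"
  shows "(f has_derivative f') (at x)"
proof (rule has_derivative_transform_within_open[of "\<lambda>y. f (y + p)"])
  have "((\<lambda>y. y + p) has_derivative (\<lambda>h. h)) (at x)"
    by (auto intro!: derivative_eq_intros)
  from has_derivative_compose[OF this f]
  show "((\<lambda>y. f (y + p)) has_derivative f') (at x)" by simp
qed (use assms in auto)

definition unit_tube :: "(real \<times> real \<times> complex) set" where
  "unit_tube = UNIV \<times> UNIV \<times> ball 0 1"

lemma open_unit_tube: "open unit_tube"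
  unfolding unit_tube_def by (intro open_Times) auto

lemma mem_unit_tube [simp]: "(s, t, z) \<in> unit_tube \<longleftrightarrow> norm z < 1"
  by (simp add: unit_tube_def)

text \<open>
  The radius is uniform in \<open>s\<close> and \<open>t\<close> by the tube lemma, applied to the compact set of all \<open>(s, t)\<close>, and of
  all \<open>(s, t, t')\<close>, with \<open>t\<close> and \<open>t'\<close> restricted to one period. What remains is a statement near each
  point. If \<open>t\<close> and \<open>t'\<close> differ on the circle, then the core points differ, and so do all points nearby.
  Otherwise \<open>t\<close> and \<open>t'\<close> agree after a shift by periods, and the map \<open>(s, t, z) \<mapsto> (s, G (s, t, z))\<close> is
  locally injective, as the determinant condition makes its derivative injective; the additional
  component \<open>s\<close> yields injectivity in \<open>(t, z)\<close> on a neighbourhood that is uniform in \<open>s\<close>.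
\<close>

lemma uniform_tube:
  fixes G :: "real \<times> real \<times> complex \<Rightarrow> complex \<times> complex"
  defines "D \<equiv> \<lambda>x. frechet_derivative G (at x)"
  assumes smooth: "smooth_on unit_tube G"
    and per: "\<And>s t z. norm z < 1 \<Longrightarrow> G (s, t + 2 * pi, z) = G (s, t, z)"
    and core: "\<And>s t t'. s \<in> {0..1} \<Longrightarrow> G (s, t, 0) = G (s, t', 0) \<Longrightarrow> cis t = cis t'"
    and lin: "\<And>s t \<zeta>. D (s, t, 0) (0, 0, \<zeta>) = cscale \<zeta> (D (s, t, 0) (0, 0, 1))"
    and det: "\<And>s t. s \<in> {0..1} \<Longrightarrow> cdet (D (s, t, 0) (0, 1, 0)) (D (s, t, 0) (0, 0, 1)) \<noteq> 0"
  obtains \<epsilon> where "0 < \<epsilon>" "\<epsilon> < 1"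
    and "\<And>s t z. s \<in> {0..1} \<Longrightarrow> norm z \<le> \<epsilon> \<Longrightarrow> cdet (D (s, t, z) (0, 1, 0)) (D (s, t, z) (0, 0, 1)) \<noteq> 0"
    and "\<And>s t z t' z'. s \<in> {0..1} \<Longrightarrow> norm z \<le> \<epsilon> \<Longrightarrow> norm z' \<le> \<epsilon> \<Longrightarrow>
      G (s, t, z) = G (s, t', z') \<Longrightarrow> cis t = cis t' \<and> z = z'"
proof -
  have dG: "(G has_derivative D x) (at x)" if "x \<in> unit_tube" for x
    unfolding D_def using smooth open_unit_tube that by (rule smooth_on_has_derivative)
  have cG: "isCont G x" if "x \<in> unit_tube" for x
    using dG[OF that] by (rule has_derivative_continuous)
  have perm: "G (s, t + 2 * pi * of_int m, z) = G (s, t, z)" if "norm z < 1" for s t m z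
    using periodic_shift_int[of "\<lambda>t. G (s, t, z)" "2 * pi"] per[OF that] by simp
  have perD: "D (s, t + 2 * pi * of_int m, z) = D (s, t, z)" if "norm z < 1" for s t m z
  proof -
    have "(G has_derivative D (s, t + 2 * pi * of_int m, z)) (at (s, t, z))"
      by (rule has_derivative_at_translate[OF open_unit_tube, of _ _ _ "(0, 2 * pi * of_int m, 0)"])
        (use dG[of "(s, t + 2 * pi * of_int m, z)"] perm that in \<open>auto simp: unit_tube_def\<close>)
    then show ?thesis using dG[of "(s, t, z)"] that has_derivative_unique by simp blast
  qed
  define \<delta> where "\<delta> x = cdet (D x (0, 1, 0)) (D x (0, 0, 1))" for x
  have "continuous_on unit_tube \<delta>"
    unfolding \<delta>_def D_def
    by (intro bounded_bilinear.continuous_on[OF bounded_bilinear_cdet] smooth_on_imp_continuous_on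
        smooth_on_frechet_derivative smooth open_unit_tube)
  then have c\<delta>: "isCont \<delta> x" if "x \<in> unit_tube" for x
    using that open_unit_tube continuous_on_eq_continuous_at by blast
  let ?K1 = "{0..1::real} \<times> {0..2 * pi}"
  have ev1: "\<forall>\<^sub>F z in nhds 0. \<forall>k\<in>?K1. (\<lambda>(z, s, t). \<delta> (s, t, z) \<noteq> 0) (z, k)"
  proof (rule eventually_nhds_uniform)
    fix k assume "k \<in> ?K1"
    then obtain s t where k: "k = (s, t)" "s \<in> {0..1}" by auto
    have "((\<lambda>p. (fst (snd p), snd (snd p), fst p)) \<longlongrightarrow> (s, t, 0 :: complex)) (nhds (0, k))"
      by (intro isCont_imp_tendsto_nhds continuous_intros) (simp add: k(1))
    then have "((\<lambda>p. \<delta> (fst (snd p), snd (snd p), fst p)) \<longlongrightarrow> \<delta> (s, t, 0 :: complex)) (nhds (0, k))"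
      by (intro isCont_tendsto_compose[OF c\<delta>]) auto
    then have "\<forall>\<^sub>F p in nhds (0, k). \<delta> (fst (snd p), snd (snd p), fst p) \<noteq> 0"
      by (rule tendsto_imp_eventually_ne) (use det[OF k(2)] in \<open>simp add: \<delta>_def\<close>)
    then show "\<forall>\<^sub>F p in nhds (0, k). (\<lambda>(z, s, t). \<delta> (s, t, z) \<noteq> 0) p"
      by (simp add: case_prod_beta)
  qed (intro compact_Times compact_Icc)
  let ?K2 = "{0..1::real} \<times> {0..2 * pi} \<times> {0..2 * pi}"
  define Q where "Q = (\<lambda>((z, z'), s, t, t'). G (s, t, z) = G (s, t', z') \<longrightarrow> cis t = cis t' \<and> z = z')"
  have ev2: "\<forall>\<^sub>F zz in nhds (0, 0). \<forall>k\<in>?K2. Q (zz, k)"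
  proof (rule eventually_nhds_uniform)
    fix k assume "k \<in> ?K2"
    then obtain s t t' where k: "k = (s, t, t')" "s \<in> {0..1}" by auto
    let ?N = "nhds ((0 :: complex, 0 :: complex), k)"
    have l1: "((\<lambda>p. (fst (snd p), fst (snd (snd p)), fst (fst p))) \<longlongrightarrow> (s, t, 0)) ?N"
      by (intro isCont_imp_tendsto_nhds continuous_intros) (simp add: k(1))
    have l2: "((\<lambda>p. (fst (snd p), snd (snd (snd p)) - c, snd (fst p))) \<longlongrightarrow> (s, t' - c, 0)) ?N" for c
      by (intro isCont_imp_tendsto_nhds continuous_intros) (simp add: k(1))
    show "\<forall>\<^sub>F p in ?N. Q p"
    proof (cases "cis t = cis t'")
      case False
      then have "G (s, t, 0) - G (s, t', 0) \<noteq> 0" using core[OF k(2), of t t'] by auto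
      moreover have "((\<lambda>p. G (fst (snd p), fst (snd (snd p)), fst (fst p))
          - G (fst (snd p), snd (snd (snd p)), snd (fst p))) \<longlongrightarrow> G (s, t, 0) - G (s, t', 0)) ?N"
        using l2[of 0] by (intro tendsto_diff isCont_tendsto_compose[OF cG] l1) auto
      ultimately have "\<forall>\<^sub>F p in ?N. G (fst (snd p), fst (snd (snd p)), fst (fst p))
          - G (fst (snd p), snd (snd (snd p)), snd (fst p)) \<noteq> 0"
        by (intro tendsto_imp_eventually_ne)
      then show ?thesis by eventually_elim (auto simp: Q_def)
    next
      case True
      then obtain m :: int where m: "t' = t + 2 * pi * of_int m"
        using cis_eq_iff_shift[of t' t] by auto
      let ?c = "2 * pi * real_of_int m"
      define H where "H x = (fst x, G x)" for x
      have sH: "smooth_on unit_tube H" unfolding H_def by (intro smooth_on_intros smooth)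
      have a: "(s, t, 0) \<in> unit_tube" by simp
      have dH: "(H has_derivative (\<lambda>h. (fst h, D (s, t, 0) h))) (at (s, t, 0))"
        unfolding H_def by (intro has_derivative_Pair dG[OF a] has_derivative_fst has_derivative_ident)
      have "inj (\<lambda>h. (fst h, D (s, t, 0) h))"
        unfolding linear_injective_0[OF has_derivative_linear[OF dH]]
      proof clarify
        fix a \<tau> and \<zeta> :: complex
        assume 0: "(fst (a, \<tau>, \<zeta>), D (s, t, 0) (a, \<tau>, \<zeta>)) = 0"
        then have "a = 0" by (simp add: zero_prod_def)
        let ?A = "D (s, t, 0) (0, 1, 0)" and ?B = "D (s, t, 0) (0, 0, 1)"
        have L: "linear (D (s, t, 0))" using dG[OF a] by (rule has_derivative_linear)
        have "D (s, t, 0) (0, \<tau>, 0) = \<tau> *\<^sub>R ?A"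
          using linear_scale[OF L, of \<tau> "(0, 1, 0)"] by simp
        moreover have "D (s, t, 0) (0, \<tau>, 0) + D (s, t, 0) (0, 0, \<zeta>) = 0"
          using 0 \<open>a = 0\<close> linear_add[OF L, of "(0, \<tau>, 0)" "(0, 0, \<zeta>)"]
          by (simp add: zero_prod_def)
        ultimately have *: "\<tau> *\<^sub>R ?A + cscale \<zeta> ?B = 0"
          using lin[of s t \<zeta>] by simp
        have "cdet (\<tau> *\<^sub>R ?A + cscale \<zeta> ?B) ?B = 0" "cdet ?A (\<tau> *\<^sub>R ?A + cscale \<zeta> ?B) = 0"
          unfolding * by simp_all
        then have "\<tau> = 0" "\<zeta> = 0"
          using det[OF k(2), of t] by (simp_all add: scaleR_eq_cscale)
        then show "(a, \<tau>, \<zeta>) = 0" using \<open>a = 0\<close> by (simp add: zero_prod_def)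
      qed
      then have "inj (frechet_derivative H (at (s, t, 0)))"
        using frechet_derivative_at[OF dH] by simp
      then obtain r where r: "r > 0" "ball (s, t, 0) r \<subseteq> unit_tube" "inj_on H (ball (s, t, 0) r)"
        using smooth_locally_injective[OF sH open_unit_tube a] by blast
      have e1: "\<forall>\<^sub>F p in ?N. (fst (snd p), fst (snd (snd p)), fst (fst p)) \<in> ball (s, t, 0) r"
        by (rule topological_tendstoD[OF l1]) (use r(1) in auto)
      have e2: "\<forall>\<^sub>F p in ?N. (fst (snd p), snd (snd (snd p)) - ?c, snd (fst p)) \<in> ball (s, t, 0) r"
        by (rule topological_tendstoD[OF l2]) (use r(1) m in auto)
      from e1 e2 show ?thesis
      proof eventually_elim
        case (elim p)
        obtain z z' s1 t1 t1' where p: "p = ((z, z'), s1, t1, t1')" by (metis surj_pair)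
        show ?case
          unfolding p Q_def prod.case
        proof
          assume eq: "G (s1, t1, z) = G (s1, t1', z')"
          have "norm z' < 1" using elim(2) r(2) by (auto simp: p unit_tube_def)
          then have "G (s1, t1' - ?c, z') = G (s1, t1', z')"
            using perm[of z' s1 "t1' - ?c" m] by simp
          then have "H (s1, t1, z) = H (s1, t1' - ?c, z')" using eq by (simp add: H_def)
          then have "(s1, t1, z) = (s1, t1' - ?c, z')"
            by (rule inj_onD[OF r(3)]) (use elim in \<open>simp_all add: p\<close>)
          then show "cis t1 = cis t1' \<and> z = z'"
            using cis_eq_iff_shift[of t1' t1] by (auto intro: exI[of _ m])
        qed
      qed
    qed
  qed (intro compact_Times compact_Icc)
  obtain d1 where d1: "d1 > 0" "\<And>z. dist z 0 < d1 \<Longrightarrow> \<forall>k\<in>?K1. (\<lambda>(z, s, t). \<delta> (s, t, z) \<noteq> 0) (z, k)"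
    using ev1 unfolding eventually_nhds_metric by blast
  obtain d2 where d2: "d2 > 0" "\<And>zz. dist zz (0, 0) < d2 \<Longrightarrow> \<forall>k\<in>?K2. Q (zz, k)"
    using ev2 unfolding eventually_nhds_metric by blast
  define \<epsilon> where "\<epsilon> = min (1 / 2) (min (d1 / 2) (d2 / 4))"
  have \<epsilon>: "0 < \<epsilon>" "\<epsilon> < 1" "\<epsilon> < d1" "\<epsilon> + \<epsilon> < d2" using d1 d2 by (auto simp: \<epsilon>_def)
  have red: "\<exists>m::int. t + 2 * pi * of_int m \<in> {0..2 * pi}" for t
  proof -
    obtain m :: int where "t + 2 * pi * of_int m \<in> {0..<0 + 2 * pi}"
      using ex_shift_into_period by blast
    then show ?thesis by (intro exI[of _ m]) simp
  qed
  show ?thesis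
  proof (rule that[OF \<epsilon>(1,2)])
    fix s t :: real and z :: complex
    assume s: "s \<in> {0..1}" and z: "norm z \<le> \<epsilon>"
    obtain m :: int where m: "t + 2 * pi * of_int m \<in> {0..2 * pi}" using red by blast
    then have "\<delta> (s, t + 2 * pi * of_int m, z) \<noteq> 0"
      using d1(2)[of z] s z \<epsilon>(3) by fastforce
    then show "cdet (D (s, t, z) (0, 1, 0)) (D (s, t, z) (0, 0, 1)) \<noteq> 0"
      using perD[of z s t m] z \<epsilon>(2) by (simp add: \<delta>_def)
  next
    fix s t t' :: real and z z' :: complex
    assume s: "s \<in> {0..1}" and z: "norm z \<le> \<epsilon>" "norm z' \<le> \<epsilon>" and eq: "G (s, t, z) = G (s, t', z')"
    obtain m n :: int where mn: "t + 2 * pi * of_int m \<in> {0..2 * pi}" "t' + 2 * pi * of_int n \<in> {0..2 * pi}"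
      using red by meson
    have "norm (z, z') \<le> norm z + norm z'" by (rule norm_Pair_le)
    then have "dist (z, z') (0, 0) < d2" using z \<epsilon>(4) by (simp add: dist_norm)
    then have "Q ((z, z'), s, t + 2 * pi * of_int m, t' + 2 * pi * of_int n)"
      using d2(2) s mn by blast
    moreover have "G (s, t + 2 * pi * of_int m, z) = G (s, t' + 2 * pi * of_int n, z')"
      using perm[of z] perm[of z'] z \<epsilon>(2) eq by simp
    ultimately have "cis (t + 2 * pi * of_int m) = cis (t' + 2 * pi * of_int n)" "z = z'"
      by (auto simp: Q_def)
    moreover have "cis (t + 2 * pi * of_int m) = cis t" for t m
      unfolding cis_eq_iff_shift by blast
    ultimately show "cis t = cis t' \<and> z = z'" by simp
  qed
qed

section \<open>Boundary tori of disc bundles\<close>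

text \<open>
  This reduces both properties required of a stage of the isotopy to a disc bundle \<open>H\<close> with
  nonvanishing determinant. The rotation of the discs by \<open>k t\<close> only adds a complex multiple of \<open>\<partial>\<^sub>z H\<close> to
  \<open>\<partial>\<^sub>t H\<close>, the angular derivative is \<open>\<partial>\<^sub>z H\<close> times a nonzero complex number, and a complex linear
  isomorphism multiplies the determinant by a nonzero constant.
\<close>

lemma rotated_tube_torus:
  fixes H :: "real \<times> complex \<Rightarrow> complex \<times> complex" and k :: int
  assumes r: "r > 0" and p: "p \<noteq> 0"
    and per: "\<And>t z. norm z = r \<Longrightarrow> H (t + 2 * pi, z) = H (t, z)"
    and inj: "\<And>t t' z z'. norm z = r \<Longrightarrow> norm z' = r \<Longrightarrow> H (t, z) = H (t', z') \<Longrightarrow>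
      cis t = cis t' \<and> z = z'"
    and der: "\<And>t z. norm z = r \<Longrightarrow> \<exists>A B. (H has_derivative (\<lambda>(\<tau>, \<zeta>). \<tau> *\<^sub>R A + cscale \<zeta> B)) (at (t, z)) \<and>
      cdet A B \<noteq> 0"
    and f: "\<And>t z. f (t, z) = frame_map p (H (t, of_real r * cis (of_int k * t) * z))"
    and smooth: "smooth_on UNIV (\<lambda>(t, \<theta>). f (t, cis \<theta>))"
  shows "torus_embedding f \<and> totally_real_torus (boundary_image f)"
proof -
  have derf: "\<exists>A B. ((\<lambda>(t, \<theta>). f (t, cis \<theta>)) has_derivative (\<lambda>(\<tau>, \<eta>). \<tau> *\<^sub>R A + \<eta> *\<^sub>R B)) (at (t, \<theta>)) \<and>
    cdet A B \<noteq> 0" for t \<theta>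
  proof -
    let ?z = "of_real r * cis (of_int k * t + \<theta>)"
    have "norm ?z = r" using r by (simp add: norm_mult)
    then obtain A B where AB: "(H has_derivative (\<lambda>(\<tau>, \<zeta>). \<tau> *\<^sub>R A + cscale \<zeta> B)) (at (t, ?z))" "cdet A B \<noteq> 0"
      using der by blast
    define \<iota> where "\<iota> x = (fst x, of_real r * cis (of_int k * fst x + snd x))" for x :: "real \<times> real"
    have "((\<lambda>x. cis (of_int k * fst x + snd x)) has_derivative
        (\<lambda>h. (of_int k * fst h + snd h) *\<^sub>R (\<i> * cis (of_int k * t + \<theta>)))) (at (t, \<theta>))"
      using has_derivative_cis[of "\<lambda>x. of_int k * fst x + snd x" "\<lambda>h. of_int k * fst h + snd h" "(t, \<theta>)" UNIV]
      by (auto intro!: derivative_eq_intros)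
    then have d\<iota>: "(\<iota> has_derivative (\<lambda>h. (fst h, \<i> * ?z * of_real (of_int k * fst h + snd h)))) (at (t, \<theta>))"
      unfolding \<iota>_def
      by (auto intro!: derivative_eq_intros simp: scaleR_conv_of_real mult_ac)
    let ?A = "frame_map p (A + cscale (of_int k * (\<i> * ?z)) B)" and ?B = "frame_map p (cscale (\<i> * ?z) B)"
    have "(H has_derivative (\<lambda>(\<tau>, \<zeta>). \<tau> *\<^sub>R A + cscale \<zeta> B)) (at (\<iota> (t, \<theta>)))"
      using AB(1) by (simp add: \<iota>_def)
    from bounded_linear.has_derivative[OF bounded_linear_frame_map has_derivative_compose[OF d\<iota> this]]
    have "((\<lambda>x. frame_map p (H (\<iota> x))) has_derivative
        (\<lambda>h. frame_map p (fst h *\<^sub>R A + cscale (\<i> * ?z * of_real (of_int k * fst h + snd h)) B))) (at (t, \<theta>))"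
      by simp
    moreover have "(\<lambda>x. frame_map p (H (\<iota> x))) = (\<lambda>(t, \<theta>). f (t, cis \<theta>))"
      by (auto simp: f \<iota>_def cis_mult mult.assoc)
    moreover have "(\<lambda>h. frame_map p (fst h *\<^sub>R A + cscale (\<i> * ?z * of_real (of_int k * fst h + snd h)) B))
        = (\<lambda>(\<tau>, \<eta>). \<tau> *\<^sub>R ?A + \<eta> *\<^sub>R ?B)"
      by (auto simp: frame_map_def prod_eq_iff scaleR_eq_cscale algebra_simps)
    ultimately have "((\<lambda>(t, \<theta>). f (t, cis \<theta>)) has_derivative (\<lambda>(\<tau>, \<eta>). \<tau> *\<^sub>R ?A + \<eta> *\<^sub>R ?B)) (at (t, \<theta>))"
      by simp
    moreover have "cdet ?A ?B \<noteq> 0"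
      using AB(2) p r by (simp add: cdet_frame_map)
    ultimately show ?thesis by blast
  qed
  have emb: "torus_embedding f"
    unfolding torus_embedding_def
  proof (intro conjI smooth)
    show "circle_periodic_on (sphere 0 1) f"
      unfolding circle_periodic_on_def
      using per r cis_int_mult_period[of k] by (auto simp: f norm_mult)
    show "immersion_on UNIV (\<lambda>(t, \<theta>). f (t, cis \<theta>))"
      unfolding immersion_on_def
    proof clarify
      fix t \<theta> :: real
      obtain A B where AB: "((\<lambda>(t, \<theta>). f (t, cis \<theta>)) has_derivative (\<lambda>(\<tau>, \<eta>). \<tau> *\<^sub>R A + \<eta> *\<^sub>R B)) (at (t, \<theta>))"
        "cdet A B \<noteq> 0"
        using derf by blast
      have "inj (\<lambda>(\<tau>, \<eta>). \<tau> *\<^sub>R A + \<eta> *\<^sub>R B)"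
        unfolding linear_injective_0[OF has_derivative_linear[OF AB(1)]]
        using cdet_nonzero_real_independent[OF AB(2)] by (auto simp: zero_prod_def)
      with AB(1) show "\<exists>D. ((\<lambda>(t, \<theta>). f (t, cis \<theta>)) has_derivative D) (at (t, \<theta>)) \<and> inj D" by blast
    qed
    show "inj_on f ({0..<2 * pi} \<times> sphere 0 1)"
    proof (rule inj_on_torusI)
      fix t t' :: real and z z' :: complex
      assume z: "z \<in> sphere 0 1" "z' \<in> sphere 0 1" and eq: "f (t, z) = f (t', z')"
      have *: "cis t = cis t' \<and> of_real r * cis (of_int k * t) * z = of_real r * cis (of_int k * t') * z'"
        by (rule inj) (use z eq r p in \<open>auto simp: f norm_mult frame_map_eq_iff\<close>)
      then have "cis (of_int k * t) = cis (of_int k * t')"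
        by (metis cis_power_int)
      then show "cis t = cis t' \<and> z = z'" using * r by simp
    qed
  qed
  with totally_real_torusI[OF emb derf] show ?thesis by blast
qed

section \<open>The discs of an analytic filling\<close>

lemma holomorphic_derivative_complex_linear:
  fixes h :: "complex \<Rightarrow> complex \<times> complex"
  assumes h: "(h has_derivative D) (at z)" and "open S" "z \<in> S"
    and hol: "(\<lambda>z. fst (h z)) holomorphic_on S" "(\<lambda>z. snd (h z)) holomorphic_on S"
  shows "D \<zeta> = cscale \<zeta> (D 1)"
proof -
  obtain a b where ab: "((\<lambda>z. fst (h z)) has_field_derivative a) (at z)"
    "((\<lambda>z. snd (h z)) has_field_derivative b) (at z)"
    using hol assms(2,3) by (metis holomorphic_on_open)
  have "(\<lambda>\<zeta>. fst (D \<zeta>)) = (*) a" "(\<lambda>\<zeta>. snd (D \<zeta>)) = (*) b"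
    using has_derivative_unique[OF has_derivative_fst[OF h] ab(1)[unfolded has_field_derivative_def]]
      has_derivative_unique[OF has_derivative_snd[OF h] ab(2)[unfolded has_field_derivative_def]]
    by simp_all
  then have "fst (D \<zeta>) = a * \<zeta>" "snd (D \<zeta>) = b * \<zeta>" for \<zeta> by metis+
  then show ?thesis by (simp add: prod_eq_iff mult.commute)
qed

lemma cdet_eq_0_imp_proportional:
  assumes "cdet A B = 0" "B \<noteq> 0"
  obtains c where "A = cscale c B"
proof (cases "fst B = 0")
  case True
  then show ?thesis
    using assms by (intro that[of "snd A / snd B"]) (auto simp: cdet_def prod_eq_iff)
next
  case False
  then show ?thesis
    using assms by (intro that[of "fst A / fst B"]) (auto simp: cdet_def prod_eq_iff field_simps)
qed

text \<open>
  If \<open>\<partial>\<^sub>t F\<close> were a complex multiple \<open>c \<partial>\<^sub>z F\<close>, then the derivative of \<open>F\<close>, being complex linear in \<open>z\<close>,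
  would annihilate \<open>(1, - c)\<close>.
\<close>

lemma filling_interior_derivative:
  fixes F :: "real \<times> complex \<Rightarrow> complex \<times> complex" and t :: real and z :: complex
  assumes fill: "analytic_filling T F" and z: "norm z < 1"
  defines "D \<equiv> frechet_derivative F (at (t, z))"
  shows "(F has_derivative D) (at (t, z))"
    and "D (0, \<zeta>) = cscale \<zeta> (D (0, 1))"
    and "D = (\<lambda>(\<tau>, \<zeta>). \<tau> *\<^sub>R D (1, 0) + cscale \<zeta> (D (0, 1)))"
    and "cdet (D (1, 0)) (D (0, 1)) \<noteq> 0"
proof -
  let ?S = "UNIV \<times> cball 0 1 :: (real \<times> complex) set"
  have emb: "smooth_on ?S F" "immersion_on ?S F"
    and hol: "(\<lambda>z. fst (F (t, z))) holomorphic_on ball 0 1" "(\<lambda>z. snd (F (t, z))) holomorphic_on ball 0 1"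
    using fill by (auto simp: analytic_filling_def solid_torus_embedding_def)
  have op: "open (UNIV \<times> ball 0 1 :: (real \<times> complex) set)" by (intro open_Times) auto
  have "smooth_on (UNIV \<times> ball 0 1) F"
    by (rule smooth_on_subset[OF emb(1)]) auto
  then show der: "(F has_derivative D) (at (t, z))"
    unfolding D_def using op by (rule smooth_on_has_derivative) (use z in auto)
  have L: "linear D" using der by (rule has_derivative_linear)
  have "((\<lambda>\<zeta>. (t, \<zeta>)) has_derivative (\<lambda>\<zeta>. (0, \<zeta>))) (at z)"
    by (auto intro!: derivative_eq_intros)
  from has_derivative_compose[OF this der]
  have dz: "((\<lambda>\<zeta>. F (t, \<zeta>)) has_derivative (\<lambda>\<zeta>. D (0, \<zeta>))) (at z)" .
  show lin: "D (0, \<zeta>) = cscale \<zeta> (D (0, 1))" for \<zeta>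
    by (rule holomorphic_derivative_complex_linear[OF dz open_ball _ hol]) (use z in simp)
  have split: "D (\<tau>, \<zeta>) = \<tau> *\<^sub>R D (1, 0) + cscale \<zeta> (D (0, 1))" for \<tau> \<zeta>
    using linear_add[OF L, of "(\<tau>, 0)" "(0, \<zeta>)"] linear_scale[OF L, of \<tau> "(1, 0)"] lin[of \<zeta>]
    by simp
  show "D = (\<lambda>(\<tau>, \<zeta>). \<tau> *\<^sub>R D (1, 0) + cscale \<zeta> (D (0, 1)))"
  proof
    fix x
    show "D x = (case x of (\<tau>, \<zeta>) \<Rightarrow> \<tau> *\<^sub>R D (1, 0) + cscale \<zeta> (D (0, 1)))"
      using split[of "fst x" "snd x"] by (simp only: case_prod_beta prod.collapse)
  qed
  have "(t, z) \<in> ?S" using z by simp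
  then obtain D' where D': "(F has_derivative D') (at (t, z) within ?S)" "inj D'"
    using emb(2) unfolding immersion_on_def by blast
  have "(t, z) \<in> interior ?S"
    using z op by (intro interiorI[of "UNIV \<times> ball 0 1"]) auto
  then have "at (t, z) within ?S = at (t, z)" by (rule at_within_interior)
  with D'(1) have "(F has_derivative D') (at (t, z))" by metis
  then have "D' = D" using der by (rule has_derivative_unique)
  then have inj: "inj D" using D'(2) by simp
  show "cdet (D (1, 0)) (D (0, 1)) \<noteq> 0"
  proof
    assume 0: "cdet (D (1, 0)) (D (0, 1)) = 0"
    have inj0: "x = 0" if "D x = 0" for x
      using injD[OF inj, of x 0] linear_0[OF L] that by simp
    have "D (0, 1) \<noteq> 0" using inj0[of "(0, 1)"] by (auto simp: zero_prod_def)
    then obtain c where c: "D (1, 0) = cscale c (D (0, 1))"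
      using cdet_eq_0_imp_proportional[OF 0] by blast
    have "D (1, - c) = 1 *\<^sub>R D (1, 0) + cscale (- c) (D (0, 1))" by (rule split)
    also have "\<dots> = 0" unfolding c by (simp add: prod_eq_iff)
    finally have "D (1, - c) = 0" .
    then show False using inj0[of "(1, - c)"] by (simp add: zero_prod_def)
  qed
qed

lemma boundary_image_disc_twist: "boundary_image (disc_twist k F) = boundary_image F"
proof
  show "boundary_image (disc_twist k F) \<subseteq> boundary_image F"
    unfolding boundary_image_def disc_twist_def by (auto simp: norm_mult)
  show "boundary_image F \<subseteq> boundary_image (disc_twist k F)"
  proof
    fix y assume "y \<in> boundary_image F"
    then obtain t z where "norm z = 1" "y = F (t, z)" by (auto simp: boundary_image_def)
    moreover obtain z' where "z = cis (of_int k * t) * z'" "norm z' = norm z"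
      by (rule that[of "z / cis (of_int k * t)"]) (simp_all add: norm_divide)
    ultimately show "y \<in> boundary_image (disc_twist k F)"
      unfolding boundary_image_def disc_twist_def
      by (intro image_eqI[of _ _ "(t, z')"]) simp_all
  qed
qed

text \<open>
  The beginning of the isotopy lies on the boundary of the discs, where \<open>F\<close> is only differentiable
  within the solid torus; the chain rule is therefore used along the inclusion of the boundary.
\<close>

lemma torus_embedding_disc_twist:
  assumes "solid_torus_embedding F"
  shows "torus_embedding (disc_twist k F)"
proof -
  let ?S = "UNIV \<times> cball 0 1 :: (real \<times> complex) set"
  have per: "circle_periodic_on (cball 0 1) F" and smooth: "smooth_on ?S F" and imm: "immersion_on ?S F"
    and inj: "inj_on F ({0..<2 * pi} \<times> cball 0 1)"
    using assms by (auto simp: solid_torus_embedding_def)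
  define \<iota> where "\<iota> x = (fst x, cis (of_int k * fst x + snd x))" for x :: "real \<times> real"
  have eq: "(\<lambda>(t, \<theta>). disc_twist k F (t, cis \<theta>)) = (\<lambda>x. F (\<iota> x))"
    by (auto simp: disc_twist_def \<iota>_def cis_mult)
  have sub: "range \<iota> \<subseteq> ?S" by (auto simp: \<iota>_def)
  show ?thesis
    unfolding torus_embedding_def eq
  proof (intro conjI)
    show "circle_periodic_on (sphere 0 1) (disc_twist k F)"
      unfolding circle_periodic_on_def disc_twist_def
      using per cis_int_mult_period[of k] by (auto simp: circle_periodic_on_def norm_mult)
    have "smooth_on UNIV \<iota>" unfolding \<iota>_def by (intro smooth_on_intros)
    then show "smooth_on UNIV (\<lambda>x. F (\<iota> x))"
      by (rule smooth_on_compose[OF smooth]) (rule sub)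
    show "immersion_on UNIV (\<lambda>x. F (\<iota> x))"
      unfolding immersion_on_def
    proof
      fix x :: "real \<times> real"
      let ?c = "cis (of_int k * fst x + snd x)"
      obtain D where D: "(F has_derivative D) (at (\<iota> x) within ?S)" "inj D"
        using imm sub unfolding immersion_on_def by blast
      have d\<iota>: "(\<iota> has_derivative (\<lambda>h. (fst h, (of_int k * fst h + snd h) *\<^sub>R (\<i> * ?c)))) (at x)"
        unfolding \<iota>_def by (auto intro!: derivative_eq_intros)
      have "((\<lambda>x. F (\<iota> x)) has_derivative (\<lambda>h. D (fst h, (of_int k * fst h + snd h) *\<^sub>R (\<i> * ?c)))) (at x)"
        by (rule has_derivative_in_compose[OF d\<iota>, of F D]) (rule has_derivative_subset[OF D(1) sub])
      moreover have "inj (\<lambda>h. D (fst h, (of_int k * fst h + snd h) *\<^sub>R (\<i> * ?c)))"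
      proof (rule injI)
        fix h h' assume "D (fst h, (of_int k * fst h + snd h) *\<^sub>R (\<i> * ?c))
          = D (fst h', (of_int k * fst h' + snd h') *\<^sub>R (\<i> * ?c))"
        then have "fst h = fst h'" "(of_int k * fst h + snd h) *\<^sub>R (\<i> * ?c) = (of_int k * fst h' + snd h') *\<^sub>R (\<i> * ?c)"
          using injD[OF D(2)] by blast+
        then show "h = h'" by (simp add: prod_eq_iff)
      qed
      ultimately show "\<exists>D. ((\<lambda>x. F (\<iota> x)) has_derivative D) (at x) \<and> inj D" by blast
    qed
    show "inj_on (disc_twist k F) ({0..<2 * pi} \<times> sphere 0 1)"
    proof (rule inj_on_torusI)
      fix t t' :: real and z z' :: complex
      assume z: "z \<in> sphere 0 1" "z' \<in> sphere 0 1" and eq: "disc_twist k F (t, z) = disc_twist k F (t', z')"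
      have *: "cis t = cis t'" "cis (of_int k * t) * z = cis (of_int k * t') * z'"
        using torus_map_eq_iff[OF per inj, of "cis (of_int k * t) * z" "cis (of_int k * t') * z'" t t'] z eq
        by (auto simp: disc_twist_def norm_mult)
      then have "cis (of_int k * t) = cis (of_int k * t')" by (metis cis_power_int)
      then show "cis t = cis t' \<and> z = z'" using * by simp
    qed
  qed
qed

section \<open>Straightening the core and the discs simultaneously\<close>

text \<open>
  The family is \<open>G\<^sub>s(t, z) = \<gamma>\<^sub>s(t) + z V\<^sub>s(t) + (1 - s) (F (t, z) - \<gamma>(t) - z v(t))\<close>, with the core \<open>\<gamma>\<^sub>s\<close> from
  \<open>generic_circle\<close> and the directions \<open>V\<^sub>s\<close> from \<open>framing_homotopy\<close>. Up to the factor
  \<open>1 - s\<close> the last summand is the part of \<open>F\<close> of order at least two in \<open>z\<close>. It vanishes to first order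
  along the core, so that the hypotheses of
  \<open>uniform_tube\<close> are statements about \<open>\<gamma>\<^sub>s\<close> and \<open>V\<^sub>s\<close> only, and it makes \<open>G\<^sub>0\<close> equal to \<open>F\<close> on all of the disc.
  As \<open>F\<close> is holomorphic in the disc variable, so is every \<open>G\<^sub>s\<close>.
\<close>

lemma straightening_family:
  assumes fill: "analytic_filling T F"
  obtains m :: int and w :: "complex \<times> complex" and G :: "real \<times> real \<times> complex \<Rightarrow> complex \<times> complex"
    and \<epsilon> :: real
  where "snd w \<noteq> 0" and "smooth_on (UNIV \<times> UNIV \<times> cball 0 1) G"
    and "\<And>t z. G (0, t, z) = F (t, z)"
    and "\<And>t z. G (1, t, z) = frame_map w (cis t, cis (of_int m * t) * z)"
    and "0 < \<epsilon>" "\<epsilon> < 1"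
    and "\<And>s t z. norm z < 1 \<Longrightarrow> G (s, t + 2 * pi, z) = G (s, t, z)"
    and "\<And>s t z t' z'. s \<in> {0..1} \<Longrightarrow> norm z \<le> \<epsilon> \<Longrightarrow> norm z' \<le> \<epsilon> \<Longrightarrow>
      G (s, t, z) = G (s, t', z') \<Longrightarrow> cis t = cis t' \<and> z = z'"
    and "\<And>s t z. s \<in> {0..1} \<Longrightarrow> norm z \<le> \<epsilon> \<Longrightarrow>
      \<exists>A B. ((\<lambda>(t, z). G (s, t, z)) has_derivative (\<lambda>(\<tau>, \<zeta>). \<tau> *\<^sub>R A + cscale \<zeta> B)) (at (t, z)) \<and>
        cdet A B \<noteq> 0"
proof -
  let ?S = "UNIV \<times> cball 0 1 :: (real \<times> complex) set" and ?B = "UNIV \<times> ball 0 1 :: (real \<times> complex) set"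
  have smooth: "smooth_on ?S F" and per: "circle_periodic_on (cball 0 1) F"
    and inj: "inj_on F ({0..<2 * pi} \<times> cball 0 1)"
    using fill by (auto simp: analytic_filling_def solid_torus_embedding_def)
  have perF: "F (t + 2 * pi, z) = F (t, z)" if "norm z \<le> 1" for t z
    using per that by (simp add: circle_periodic_on_def)
  have opB: "open ?B" by (intro open_Times) auto
  have smoothB: "smooth_on ?B F" by (rule smooth_on_subset[OF smooth]) auto
  note D = filling_interior_derivative[OF fill]
  define \<gamma> where "\<gamma> t = F (t, 0)" for t
  define \<gamma>' where "\<gamma>' t = frechet_derivative F (at (t, 0)) (1, 0)" for t
  define v where "v t = frechet_derivative F (at (t, 0)) (0, 1)" for t
  have s0: "smooth_on UNIV (\<lambda>t::real. (t, 0::complex))" by (intro smooth_on_intros)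
  have s\<gamma>: "smooth_on UNIV \<gamma>" unfolding \<gamma>_def
    by (rule smooth_on_compose[OF smooth s0]) auto
  have s\<gamma>': "smooth_on UNIV \<gamma>'" and sv: "smooth_on UNIV v" unfolding \<gamma>'_def v_def
    by (rule smooth_on_compose[OF smooth_on_frechet_derivative[OF smoothB opB] s0], auto)+
  have d\<gamma>: "(\<gamma> has_derivative (\<lambda>h. h *\<^sub>R \<gamma>' t)) (at t)" for t
  proof -
    have "((\<lambda>t. (t, 0::complex)) has_derivative (\<lambda>h. (h, 0))) (at t)"
      by (auto intro!: derivative_eq_intros)
    from has_derivative_compose[OF this D(1)[of 0 t]]
    have "(\<gamma> has_derivative (\<lambda>h. frechet_derivative F (at (t, 0)) (h, 0))) (at t)"
      by (simp add: \<gamma>_def[abs_def])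
    moreover have "frechet_derivative F (at (t, 0)) (h, 0) = h *\<^sub>R \<gamma>' t" for h
      using fun_cong[OF D(3)[of 0 t], of "(h, 0)"] by (simp add: \<gamma>'_def)
    ultimately show ?thesis by simp
  qed
  have perD: "frechet_derivative F (at (t + 2 * pi, 0)) = frechet_derivative F (at (t, 0))" for t
  proof -
    have "(F has_derivative frechet_derivative F (at (t + 2 * pi, 0))) (at (t, 0))"
      by (rule has_derivative_at_translate[OF opB, of _ _ _ "(2 * pi, 0)"])
        (use D(1)[of 0 "t + 2 * pi"] perF in auto)
    then show ?thesis by (rule frechet_derivative_at)
  qed
  have core: "cis t = cis t'" if "\<gamma> t = \<gamma> t'" for t t'
    using torus_map_eq_iff(1)[OF per inj, of 0 0 t t'] that by (simp add: \<gamma>_def)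
  have det: "cdet (\<gamma>' t) (v t) \<noteq> 0" for t
    using D(4)[of 0 t] by (simp add: \<gamma>'_def v_def)
  have nz: "\<gamma>' t \<noteq> 0" for t using det[of t] by auto
  obtain w where w: "snd w \<noteq> 0"
    and w1: "\<And>s t t'. s \<in> {0..1} \<Longrightarrow>
        (1 - s) *\<^sub>R \<gamma> t + s *\<^sub>R cscale (cis t) w = (1 - s) *\<^sub>R \<gamma> t' + s *\<^sub>R cscale (cis t') w \<Longrightarrow>
        cis t = cis t'"
    and w2: "\<And>s t. s \<in> {0..1} \<Longrightarrow> (1 - s) *\<^sub>R \<gamma>' t + s *\<^sub>R cscale (\<i> * cis t) w \<noteq> 0"
  proof (rule generic_circle[OF s\<gamma> s\<gamma>' nz core])
    fix w assume "snd w \<noteq> 0" and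
      "\<And>s t t'. s \<in> {0..1} \<Longrightarrow>
        (1 - s) *\<^sub>R \<gamma> t + s *\<^sub>R cscale (cis t) w = (1 - s) *\<^sub>R \<gamma> t' + s *\<^sub>R cscale (cis t') w \<Longrightarrow>
        cis t = cis t'"
      and "\<And>s t. s \<in> {0..1} \<Longrightarrow> (1 - s) *\<^sub>R \<gamma>' t + s *\<^sub>R cscale (\<i> * cis t) w \<noteq> 0"
    then show thesis by (rule that)
  qed
  have per': "\<gamma>' (t + 2 * pi) = \<gamma>' t" "v (t + 2 * pi) = v t" for t
    by (simp_all add: \<gamma>'_def v_def perD)
  obtain m :: int and V where V: "smooth_on UNIV (\<lambda>x. V (fst x) (snd x))"
    "\<And>s t. V s (t + 2 * pi) = V s t" "\<And>t. V 0 t = v t"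
    "\<And>t. V 1 t = cscale (cis (of_int m * t)) (quat_j w)"
    "\<And>s t. s \<in> {0..1} \<Longrightarrow> cdet ((1 - s) *\<^sub>R \<gamma>' t + s *\<^sub>R cscale (\<i> * cis t) w) (V s t) \<noteq> 0"
  proof (rule framing_homotopy[OF s\<gamma>' sv per' det w2])
    fix m :: int and V
    assume "smooth_on UNIV (\<lambda>x. V (fst x) (snd x))" and "\<And>s t. V s (t + 2 * pi) = V s t"
      and "\<And>t. V 0 t = v t" and "\<And>t. V 1 t = cscale (cis (of_int m * t)) (quat_j w)"
      and "\<And>s t. s \<in> {0..1} \<Longrightarrow>
        cdet ((1 - s) *\<^sub>R \<gamma>' t + s *\<^sub>R cscale (\<i> * cis t) w) (V s t) \<noteq> 0"
    then show thesis by (rule that)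
  qed
  define G where "G x = (case x of (s, t, z) \<Rightarrow> (1 - s) *\<^sub>R \<gamma> t + s *\<^sub>R cscale (cis t) w + cscale z (V s t)
    + (1 - s) *\<^sub>R (F (t, z) - \<gamma> t - cscale z (v t)))" for x
  have sG: "smooth_on (UNIV \<times> UNIV \<times> cball 0 1) G"
    unfolding G_def case_prod_beta
    by (intro smooth_on_intros smooth_on_cscale smooth_on_compose[OF s\<gamma>] smooth_on_compose[OF sv]
        smooth_on_compose[OF V(1), of _ "\<lambda>x. (fst x, fst (snd x))", simplified]
        smooth_on_compose[OF smooth]) auto
  then have sG': "smooth_on unit_tube G"
    by (rule smooth_on_subset) (auto simp: unit_tube_def)
  define DG where "DG x = frechet_derivative G (at x)" for x
  have dG: "(G has_derivative DG x) (at x)" if "x \<in> unit_tube" for x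
    unfolding DG_def using sG' open_unit_tube that by (rule smooth_on_has_derivative)
  have perG: "G (s, t + 2 * pi, z) = G (s, t, z)" if "norm z < 1" for s t z
  proof -
    have "\<gamma> (t + 2 * pi) = \<gamma> t" "v (t + 2 * pi) = v t"
      using perF by (simp_all add: \<gamma>_def v_def perD)
    then show ?thesis
      using perF[of z t] that V(2) cis_int_mult_period[of 1 t] by (simp add: G_def)
  qed
  have dz: "DG (s, t, z) (0, 0, \<zeta>) =
    cscale \<zeta> (V s t + (1 - s) *\<^sub>R (frechet_derivative F (at (t, z)) (0, 1) - v t))" if "norm z < 1" for s t z \<zeta>
  proof -
    let ?F' = "frechet_derivative F (at (t, z)) (0, 1)"
    have "((\<lambda>z. (s, t, z)) has_derivative (\<lambda>\<zeta>. (0, 0, \<zeta>))) (at z)"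
      by (auto intro!: derivative_eq_intros)
    from has_derivative_compose[OF this dG]
    have 1: "((\<lambda>z. G (s, t, z)) has_derivative (\<lambda>\<zeta>. DG (s, t, z) (0, 0, \<zeta>))) (at z)"
      using that by simp
    have "((\<lambda>z. (t, z)) has_derivative (\<lambda>\<zeta>. (0, \<zeta>))) (at z)"
      by (auto intro!: derivative_eq_intros)
    from has_derivative_compose[OF this D(1)[OF that]]
    have dF: "((\<lambda>z. F (t, z)) has_derivative (\<lambda>\<zeta>. cscale \<zeta> ?F')) (at z)"
      by (simp only: D(2)[OF that, symmetric])
    have dc: "((\<lambda>z. cscale z c) has_derivative (\<lambda>\<zeta>. cscale \<zeta> c)) (at z)" for c
      by (rule bounded_linear_imp_has_derivative) (rule bounded_bilinear.bounded_linear_left[OF bounded_bilinear_cscale])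
    have 2: "((\<lambda>z. G (s, t, z)) has_derivative
      (\<lambda>\<zeta>. 0 + cscale \<zeta> (V s t) + (1 - s) *\<^sub>R (cscale \<zeta> ?F' - 0 - cscale \<zeta> (v t)))) (at z)"
      unfolding G_def prod.case
      by (intro has_derivative_add has_derivative_diff has_derivative_scaleR_right has_derivative_const dc dF)
    show ?thesis
      using fun_cong[OF has_derivative_unique[OF 1 2], of \<zeta>]
      by (simp add: prod_eq_iff algebra_simps)
  qed
  have dz0: "DG (s, t, 0) (0, 0, \<zeta>) = cscale \<zeta> (V s t)" for s t \<zeta>
    using dz[of 0 s t \<zeta>] by (simp add: v_def)
  have dt0: "DG (s, t, 0) (0, 1, 0) = (1 - s) *\<^sub>R \<gamma>' t + s *\<^sub>R cscale (\<i> * cis t) w" for s t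
  proof -
    have "((\<lambda>t. (s, t, 0)) has_derivative (\<lambda>h. (0, h, 0))) (at t)"
      by (auto intro!: derivative_eq_intros)
    from has_derivative_compose[OF this dG]
    have 1: "((\<lambda>t. G (s, t, 0)) has_derivative (\<lambda>h. DG (s, t, 0) (0, h, 0))) (at t)"
      by simp
    have G0: "(\<lambda>t. G (s, t, 0)) = (\<lambda>t. (1 - s) *\<^sub>R \<gamma> t + s *\<^sub>R cscale (cis t) w)"
      by (simp add: G_def \<gamma>_def)
    have "(cis has_derivative (\<lambda>h. h *\<^sub>R (\<i> * cis t))) (at t)"
      by (auto intro!: derivative_eq_intros)
    from bounded_linear.has_derivative[OF bounded_bilinear.bounded_linear_left[OF bounded_bilinear_cscale] this]
    have dw: "((\<lambda>t. cscale (cis t) w) has_derivative (\<lambda>h. cscale (h *\<^sub>R (\<i> * cis t)) w)) (at t)" .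
    have 2: "((\<lambda>t. G (s, t, 0)) has_derivative
      (\<lambda>h. (1 - s) *\<^sub>R (h *\<^sub>R \<gamma>' t) + s *\<^sub>R cscale (h *\<^sub>R (\<i> * cis t)) w)) (at t)"
      unfolding G0 by (intro has_derivative_add has_derivative_scaleR_right d\<gamma> dw)
    show ?thesis using fun_cong[OF has_derivative_unique[OF 1 2], of 1] by simp
  qed
  obtain \<epsilon> where \<epsilon>: "0 < \<epsilon>" "\<epsilon> < 1"
    and \<epsilon>1: "\<And>s t z. s \<in> {0..1} \<Longrightarrow> norm z \<le> \<epsilon> \<Longrightarrow> cdet (DG (s, t, z) (0, 1, 0)) (DG (s, t, z) (0, 0, 1)) \<noteq> 0"
    and \<epsilon>2: "\<And>s t z t' z'. s \<in> {0..1} \<Longrightarrow> norm z \<le> \<epsilon> \<Longrightarrow> norm z' \<le> \<epsilon> \<Longrightarrow>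
      G (s, t, z) = G (s, t', z') \<Longrightarrow> cis t = cis t' \<and> z = z'"
  proof (rule uniform_tube[OF sG' perG, folded DG_def])
    show "cis t = cis t'" if "s \<in> {0..1}" "G (s, t, 0) = G (s, t', 0)" for s t t'
      using w1[OF that(1), of t t'] that(2) by (simp add: G_def \<gamma>_def)
    show "DG (s, t, 0) (0, 0, \<zeta>) = cscale \<zeta> (DG (s, t, 0) (0, 0, 1))" for s t \<zeta>
      by (simp add: dz0)
    show "cdet (DG (s, t, 0) (0, 1, 0)) (DG (s, t, 0) (0, 0, 1)) \<noteq> 0" if "s \<in> {0..1}" for s t
      using V(5)[OF that] by (simp add: dz0 dt0)
  qed (assumption | blast)+
  show ?thesis
  proof (rule that[OF w sG _ _ \<epsilon> perG \<epsilon>2])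
    show "G (0, t, z) = F (t, z)" for t z by (simp add: G_def V(3))
    show "G (1, t, z) = frame_map w (cis t, cis (of_int m * t) * z)" for t z
      by (simp add: G_def V(4) frame_map_def mult.commute)
    show "\<exists>A B. ((\<lambda>(t, z). G (s, t, z)) has_derivative (\<lambda>(\<tau>, \<zeta>). \<tau> *\<^sub>R A + cscale \<zeta> B)) (at (t, z)) \<and>
        cdet A B \<noteq> 0" if "s \<in> {0..1}" "norm z \<le> \<epsilon>" for s t z
    proof (intro exI conjI)
      let ?D = "DG (s, t, z)"
      have z: "norm z < 1" using that(2) \<epsilon>(2) by simp
      have d: "(G has_derivative ?D) (at (s, t, z))" using dG z by simp
      have L: "linear ?D" using d by (rule has_derivative_linear)
      have "((\<lambda>x. (s, fst x, snd x)) has_derivative (\<lambda>h. (0, fst h, snd h))) (at (t, z))"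
        by (auto intro!: derivative_eq_intros)
      from has_derivative_compose[OF this, of G ?D] d
      have "((\<lambda>x. G (s, x)) has_derivative (\<lambda>x. ?D (0, x))) (at (t, z))"
        by simp
      moreover have "(\<lambda>x. G (s, x)) = (\<lambda>(t, z). G (s, t, z))" "(\<lambda>x. ?D (0, x)) = (\<lambda>(\<tau>, \<zeta>). ?D (0, \<tau>, \<zeta>))"
        by auto
      ultimately have "((\<lambda>(t, z). G (s, t, z)) has_derivative (\<lambda>(\<tau>, \<zeta>). ?D (0, \<tau>, \<zeta>))) (at (t, z))"
        by simp
      moreover have "(\<lambda>(\<tau>, \<zeta>). ?D (0, \<tau>, \<zeta>)) = (\<lambda>(\<tau>, \<zeta>). \<tau> *\<^sub>R ?D (0, 1, 0) + cscale \<zeta> (?D (0, 0, 1)))"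
      proof (rule ext, clarify)
        fix \<tau> and \<zeta> :: complex
        have "?D (0, \<tau>, \<zeta>) = ?D (0, \<tau>, 0) + ?D (0, 0, \<zeta>)"
          using linear_add[OF L, of "(0, \<tau>, 0)" "(0, 0, \<zeta>)"] by simp
        moreover have "?D (0, \<tau>, 0) = \<tau> *\<^sub>R ?D (0, 1, 0)"
          using linear_scale[OF L, of \<tau> "(0, 1, 0)"] by simp
        ultimately show "?D (0, \<tau>, \<zeta>) = \<tau> *\<^sub>R ?D (0, 1, 0) + cscale \<zeta> (?D (0, 0, 1))"
          by (simp add: dz[OF z])
      qed
      ultimately show "((\<lambda>(t, z). G (s, t, z)) has_derivative
        (\<lambda>(\<tau>, \<zeta>). \<tau> *\<^sub>R ?D (0, 1, 0) + cscale \<zeta> (?D (0, 0, 1)))) (at (t, z))"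
        by (simp only:)
      show "cdet (?D (0, 1, 0)) (?D (0, 0, 1)) \<noteq> 0" using \<epsilon>1 that by blast
    qed
  qed
qed

section \<open>The isotopy\<close>

theorem proposition6p1:
  fixes T :: "(complex \<times> complex) set"
    and F :: "real \<times> complex \<Rightarrow> complex \<times> complex"
  assumes "totally_real_torus T"
    and "analytic_filling T F"
  shows "\<exists>k \<Phi>. torus_isotopy \<Phi> \<and>
           (\<forall>t. \<forall>z\<in>sphere 0 1. \<Phi> 0 (t, z) = disc_twist k F (t, z)) \<and>
           (\<forall>t \<theta>. \<Phi> 1 (t, cis \<theta>) = (cis t, cis \<theta>)) \<and>
           (\<forall>s\<in>{0..1}. totally_real_torus (boundary_image (\<Phi> s)))"
proof (rule straightening_family[OF assms(2)])
  fix m :: int and w :: "complex \<times> complex" and G :: "real \<times> real \<times> complex \<Rightarrow> complex \<times> complex"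
    and \<epsilon> :: real
  assume w: "snd w \<noteq> 0" and sG: "smooth_on (UNIV \<times> UNIV \<times> cball 0 1) G"
    and G0: "\<And>t z. G (0, t, z) = F (t, z)"
    and G1: "\<And>t z. G (1, t, z) = frame_map w (cis t, cis (of_int m * t) * z)"
    and \<epsilon>: "0 < \<epsilon>" "\<epsilon> < 1"
    and perG: "\<And>s t z. norm z < 1 \<Longrightarrow> G (s, t + 2 * pi, z) = G (s, t, z)"
    and injG: "\<And>s t z t' z'. s \<in> {0..1} \<Longrightarrow> norm z \<le> \<epsilon> \<Longrightarrow> norm z' \<le> \<epsilon> \<Longrightarrow>
      G (s, t, z) = G (s, t', z') \<Longrightarrow> cis t = cis t' \<and> z = z'"
    and derG: "\<And>s t z. s \<in> {0..1} \<Longrightarrow> norm z \<le> \<epsilon> \<Longrightarrow>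
      \<exists>A B. ((\<lambda>(t, z). G (s, t, z)) has_derivative (\<lambda>(\<tau>, \<zeta>). \<tau> *\<^sub>R A + cscale \<zeta> B)) (at (t, z)) \<and>
        cdet A B \<noteq> 0"
  have emb: "solid_torus_embedding F" and T: "boundary_image F = T"
    using assms(2) by (auto simp: analytic_filling_def)
  have perF: "circle_periodic_on (cball 0 1) F" and injF: "inj_on F ({0..<2 * pi} \<times> cball 0 1)"
    using emb by (auto simp: solid_torus_embedding_def)

  define e1 :: "complex \<times> complex" where "e1 = (1, 0)"
  \<comment> \<open>The vector whose map \<open>frame_map w'\<close> is inverse to \<open>frame_map w\<close>. As \<open>snd w \<noteq> 0\<close>, it is not a real multiple
    of \<open>e1\<close>, and the segment from \<open>e1\<close> to \<open>w'\<close> avoids zero.\<close>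
  define w' where "w' = (cnj (fst w) / cdet w (quat_j w), - snd w / cdet w (quat_j w))"
  have w0: "w \<noteq> 0" using w by auto
  have w': "frame_map w' (frame_map w x) = x" for x
  proof -
    have "cdet w (quat_j w) \<noteq> 0" "cnj (cdet w (quat_j w)) = cdet w (quat_j w)" using w0 by (simp_all add: cdet_quat_j)
    then show ?thesis
      by (simp add: w'_def frame_map_def prod_eq_iff field_simps) (simp add: cdet_def algebra_simps)
  qed
  have e1: "frame_map e1 x = x" for x by (simp add: e1_def frame_map_def prod_eq_iff)
  define p where "p s = (1 - s) *\<^sub>R e1 + s *\<^sub>R w'" for s
  have p0: "p s \<noteq> 0" for s
    using w w0 by (cases "s = 0") (auto simp: p_def e1_def w'_def prod_eq_iff)

  \<comment> \<open>The path \<open>(\<sigma>, r)\<close>: on the first third of the time \<open>\<sigma> = 0\<close> and \<open>r\<close> decreases from \<open>1\<close> to \<open>\<epsilon>\<close>, on the second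
    \<open>r = \<epsilon>\<close> and \<open>\<sigma>\<close> increases to \<open>1\<close>, on the last \<open>\<sigma> = 1\<close> and \<open>r\<close> increases to \<open>1\<close>.\<close>
  define r where "r s = \<epsilon> + (1 - \<epsilon>) * ((flat (1/3 - s) + flat (s - 2/3)) / flat (1/3))" for s
  define \<sigma> where "\<sigma> s = flat (s - 1/3) / (flat (s - 1/3) + flat (2/3 - s))" for s
  have den: "flat (s - 1/3) + flat (2/3 - s) > 0" for s
    by (cases "s \<le> 1/3") (auto simp: add_pos_nonneg add_nonneg_pos)
  have \<sigma>0: "\<sigma> s = 0" if "s \<le> 1/3" for s using that by (simp add: \<sigma>_def)
  have \<sigma>1: "\<sigma> s = 1" if "s \<ge> 2/3" for s
  proof -
    have "flat (2/3 - s) = 0" using that by simp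
    then show ?thesis using den[of s] by (simp add: \<sigma>_def del: flat_pos_iff)
  qed
  have \<sigma>: "\<sigma> s \<in> {0..1}" for s using den[of s] by (simp add: \<sigma>_def)
  have r_mid: "r s = \<epsilon>" if "1/3 \<le> s" "s \<le> 2/3" for s
  proof -
    have "flat (1/3 - s) = 0" "flat (s - 2/3) = 0" using that by (auto simp: flat_def)
    then show ?thesis by (simp add: r_def)
  qed
  have r_pos: "r s > 0" for s
    using \<epsilon> by (simp add: r_def add_pos_nonneg)
  have r_le: "r s \<le> 1" and r_less: "0 < s \<Longrightarrow> s < 1 \<Longrightarrow> r s < 1" if "s \<in> {0..1}" for s
  proof -
    let ?q = "(flat (1/3 - s) + flat (s - 2/3)) / flat (1/3)"
    have "flat (1/3) > 0" by simp
    have eq: "r s = 1 - (1 - \<epsilon>) * (1 - ?q)" by (simp add: r_def algebra_simps)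
    show less: "r s < 1" if "0 < s" "s < 1"
    proof -
      have "flat (1/3 - s) < flat (1/3)" "flat (s - 2/3) < flat (1/3)"
        using that by (auto intro!: flat_strict_mono)
      moreover have "flat (1/3 - s) = 0 \<or> flat (s - 2/3) = 0" by (cases "s \<le> 1/3") auto
      ultimately have "?q < 1" by auto
      then have "0 < (1 - \<epsilon>) * (1 - ?q)" using \<epsilon>(2) by (intro mult_pos_pos) simp_all
      then show ?thesis unfolding eq by linarith
    qed
    have "r s = 1" if "s = 0 \<or> s = 1" using that by (auto simp: r_def)
    then show "r s \<le> 1"
      using less that by (cases "s = 0 \<or> s = 1") (simp_all add: less_imp_le)
  qed
  have r0: "r 0 = 1" and r1: "r 1 = 1" by (simp_all add: r_def)

  \<comment> \<open>This rotation cancels the factor \<open>cis (m * t)\<close> in \<open>G (1, t, z)\<close>.\<close>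
  define k where "k = - m"
  define \<Phi> where "\<Phi> s x = (case x of (t, z) \<Rightarrow>
    frame_map (p s) (G (\<sigma> s, t, of_real (r s) * cis (of_int k * t) * z)))" for s x
  have smooth_flat: "smooth_on S (\<lambda>x. flat (f x))" if "smooth_on S f" for S and f :: "'a::euclidean_space \<Rightarrow> real"
    by (rule smooth_on_compose[OF flat_smooth that]) simp
  have smooth_\<Phi>: "smooth_on ({0..1} \<times> UNIV \<times> UNIV) (\<lambda>(s, t, \<theta>). \<Phi> s (t, cis \<theta>))"
  proof -
    let ?S = "{0..1} \<times> UNIV \<times> UNIV :: (real \<times> real \<times> real) set"
    define q where "q x = (\<sigma> (fst x), fst (snd x),
      of_real (r (fst x)) * cis (of_int k * fst (snd x)) * cis (snd (snd x)))" for x :: "real \<times> real \<times> real"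
    have "smooth_on ?S q"
      unfolding q_def \<sigma>_def r_def
      by (intro smooth_on_intros smooth_on_divide smooth_flat)
        (use den in \<open>auto simp: less_le\<close>)
    moreover have "q ` ?S \<subseteq> UNIV \<times> UNIV \<times> cball 0 1"
      using r_le r_pos by (auto simp: q_def norm_mult abs_of_pos)
    ultimately have "smooth_on ?S (\<lambda>x. G (q x))"
      by (rule smooth_on_compose[OF sG])
    moreover have "smooth_on ?S (\<lambda>x. p (fst x))"
      unfolding p_def by (intro smooth_on_intros)
    ultimately have "smooth_on ?S (\<lambda>x. frame_map (p (fst x)) (G (q x)))"
      by (intro smooth_on_frame_map)
    then show ?thesis by (simp add: \<Phi>_def q_def case_prod_beta')
  qed
  have smooth_s: "smooth_on UNIV (\<lambda>(t, \<theta>). \<Phi> s (t, cis \<theta>))" if "s \<in> {0..1}" for s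
  proof -
    have "smooth_on UNIV (\<lambda>x :: real \<times> real. (s, x))" by (intro smooth_on_intros)
    moreover have "range (Pair s) \<subseteq> {0..1} \<times> (UNIV :: (real \<times> real) set)" using that by auto
    ultimately show ?thesis
      using smooth_on_compose[OF smooth_\<Phi>, of UNIV "Pair s"] by (simp add: case_prod_beta')
  qed

  have \<Phi>0: "\<Phi> 0 = disc_twist k F"
    by (auto simp: \<Phi>_def disc_twist_def \<sigma>0 r0 p_def e1 G0)
  have G1': "G (1, t, of_real x * cis (of_int k * t) * z) = frame_map w (cis t, of_real x * z)" for x t z
  proof -
    have "cis (of_int m * t) * cis (of_int k * t) = 1" by (simp add: k_def cis_mult)
    then have "cis (of_int m * t) * (of_real x * cis (of_int k * t) * z) = of_real x * z"
      by (metis mult.assoc mult.commute mult_1)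
    then show ?thesis unfolding G1 by (rule arg_cong)
  qed
  have \<Phi>1: "\<Phi> 1 (t, z) = (cis t, z)" for t z
    using G1'[of t 1 z] by (simp add: \<Phi>_def \<sigma>1 r1 p_def w')

  \<comment> \<open>At \<open>s = 0\<close> this is the given torus, which is totally real by hypothesis. Later on the first third,
    \<open>r s < 1\<close> keeps the torus inside the filling, where \<open>F\<close> is differentiable on a neighbourhood. On the last
    third \<open>G (1, t, z)\<close> is an explicit embedding for all \<open>z\<close>, so that radii above \<open>\<epsilon>\<close> are no problem.\<close>
  have tori: "torus_embedding (\<Phi> s) \<and> totally_real_torus (boundary_image (\<Phi> s))" if s: "s \<in> {0..1}" for s
  proof -
    have "s = 0 \<or> 0 < s \<and> s \<le> 1/3 \<or> 1/3 \<le> s \<and> s \<le> 2/3 \<or> 2/3 \<le> s" using s by auto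
    then consider "s = 0" | "0 < s" "s \<le> 1/3" | "1/3 \<le> s" "s \<le> 2/3" | "2/3 \<le> s" by blast
    then show ?thesis
    proof cases
      case 1
      then show ?thesis
        using torus_embedding_disc_twist[OF emb] assms(1) boundary_image_disc_twist[of k F] T by (simp add: \<Phi>0)
    next
      case 2
      have r: "r s < 1" using r_less[OF s] 2 by simp
      show ?thesis
      proof (rule rotated_tube_torus[OF r_pos[of s] p0[of s], of F _ k])
        show "F (t + 2 * pi, z) = F (t, z)" if "norm z = r s" for t z
          using perF that r by (simp add: circle_periodic_on_def)
        show "cis t = cis t' \<and> z = z'" if "norm z = r s" "norm z' = r s" "F (t, z) = F (t', z')" for t t' z z'
          using torus_map_eq_iff[OF perF injF _ _ that(3)] that r by simp
        show "\<exists>A B. (F has_derivative (\<lambda>(\<tau>, \<zeta>). \<tau> *\<^sub>R A + cscale \<zeta> B)) (at (t, z)) \<and> cdet A B \<noteq> 0"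
          if "norm z = r s" for t z
        proof (intro exI conjI)
          have z: "norm z < 1" using that r by simp
          note D = filling_interior_derivative[OF assms(2) z, of t]
          show "cdet (frechet_derivative F (at (t, z)) (1, 0)) (frechet_derivative F (at (t, z)) (0, 1)) \<noteq> 0"
            by (rule D(4))
          show "(F has_derivative (\<lambda>(\<tau>, \<zeta>). \<tau> *\<^sub>R frechet_derivative F (at (t, z)) (1, 0)
            + cscale \<zeta> (frechet_derivative F (at (t, z)) (0, 1)))) (at (t, z))"
            using D(1) unfolding D(3)[symmetric] .
        qed
        show "\<Phi> s (t, z) = frame_map (p s) (F (t, of_real (r s) * cis (of_int k * t) * z))" for t z
          using 2 by (simp add: \<Phi>_def \<sigma>0 G0)
      qed (rule smooth_s[OF s])
    next
      case 3
      show ?thesis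
      proof (rule rotated_tube_torus[OF \<epsilon>(1) p0[of s], of "\<lambda>(t, z). G (\<sigma> s, t, z)" _ k])
        show "(case (t + 2 * pi, z) of (t, z) \<Rightarrow> G (\<sigma> s, t, z)) = (case (t, z) of (t, z) \<Rightarrow> G (\<sigma> s, t, z))"
          if "norm z = \<epsilon>" for t z
          using perG that \<epsilon>(2) by simp
        show "cis t = cis t' \<and> z = z'" if "norm z = \<epsilon>" "norm z' = \<epsilon>"
          "(case (t, z) of (t, z) \<Rightarrow> G (\<sigma> s, t, z)) = (case (t', z') of (t, z) \<Rightarrow> G (\<sigma> s, t, z))" for t t' z z'
          using injG[OF \<sigma>, of z z' s t t'] that by simp
        show "\<exists>A B. ((\<lambda>(t, z). G (\<sigma> s, t, z)) has_derivative (\<lambda>(\<tau>, \<zeta>). \<tau> *\<^sub>R A + cscale \<zeta> B)) (at (t, z)) \<and>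
          cdet A B \<noteq> 0" if "norm z = \<epsilon>" for t z
          using derG[OF \<sigma>, of z s t] that by simp
        show "\<Phi> s (t, z) = frame_map (p s) (case (t, of_real \<epsilon> * cis (of_int k * t) * z) of (t, z) \<Rightarrow> G (\<sigma> s, t, z))"
          for t z
          using 3 by (simp add: \<Phi>_def r_mid)
      qed (rule smooth_s[OF s])
    next
      case 4
      let ?H = "\<lambda>(t, z). frame_map w (cis t, z)"
      show ?thesis
      proof (rule rotated_tube_torus[OF r_pos[of s] p0[of s], of ?H _ 0])
        show "?H (t + 2 * pi, z) = ?H (t, z)" for t z
          using cis_int_mult_period[of 1 t] by simp
        show "cis t = cis t' \<and> z = z'" if "?H (t, z) = ?H (t', z')" for t t' z z'
          using that w0 by (simp add: frame_map_eq_iff)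
        show "\<exists>A B. (?H has_derivative (\<lambda>(\<tau>, \<zeta>). \<tau> *\<^sub>R A + cscale \<zeta> B)) (at (t, z)) \<and> cdet A B \<noteq> 0"
          for t z
        proof (intro exI conjI)
          have "((\<lambda>x. (cis (fst x), snd x)) has_derivative (\<lambda>h. (fst h *\<^sub>R (\<i> * cis t), snd h))) (at (t, z))"
            using has_derivative_cis[of fst fst "(t, z)" UNIV] by (auto intro!: derivative_eq_intros)
          from bounded_linear.has_derivative[OF bounded_linear_frame_map[of w] this]
          show "(?H has_derivative (\<lambda>(\<tau>, \<zeta>). \<tau> *\<^sub>R frame_map w (\<i> * cis t, 0) + cscale \<zeta> (frame_map w (0, 1)))) (at (t, z))"
            by (simp add: case_prod_beta' frame_map_def scaleR_eq_cscale scaleR_conv_of_real)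
          show "cdet (frame_map w (\<i> * cis t, 0)) (frame_map w (0, 1)) \<noteq> 0"
            using w0 by (simp add: cdet_frame_map) (simp add: cdet_def)
        qed
        show "\<Phi> s (t, z) = frame_map (p s) (?H (t, of_real (r s) * cis (of_int 0 * t) * z))" for t z
          using 4 by (simp add: \<Phi>_def \<sigma>1 G1')
      qed (rule smooth_s[OF s])
    qed
  qed
  have "torus_isotopy \<Phi>"
    unfolding torus_isotopy_def using smooth_\<Phi> tori by blast
  then show ?thesis
    using tori \<Phi>0 \<Phi>1 by (intro exI[of _ k] exI[of _ \<Phi>]) simp
qed

end
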